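(* Let $N$ be a positive integer and let $H$ be a function from $\mathbf H^2(\mathcal U,\mathcal Y)$ with Taylor coefficients $(H_n)_{n\in\mathbb N}$ at zero. Then the operator $$\begin{bmatrix}H_0&0&0&\cdots&0\\H_1&H_0&0&\cdots&0\\H_2&H_1&H_0&\cdots&0\\ \vdots&\vdots&\vdots&\ddots&\vdots\\H_{N-1}&H_{N-2}&H_{N-3}&\cdots&H_0\\ \vdots&\vdots&\vdots&\vdots&\vdots\end{bmatrix}:\mathcal U^N\to\ell^2_+(\mathcal Y)$$ (whose entry in row $m\in\{0,1,2,\ldots\}$ and column $j\in\{1,\ldots,N\}$ is $H_{m-j+1}$ if $m-j+1\ge0$ and $0$ otherwise) is a contraction if and only if there exists a Schur class function $V$ from $\mathbf S(\mathcal U,\mathcal Y\oplus\mathcal U)$ such that $$H(\lambda)=\Pi_{\mathcal Y}V(\lambda)(I-\lambda^N\Pi_{\mathcal U}V(\lambda))^{-1}\qquad(\lambda\in\mathbb D).$$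
   Context: $\mathcal U,\mathcal Y$ are Hilbert spaces; $\mathbb N=\{0,1,2,\ldots\}$; $\mathbb D$ is the open unit disc; $H^2(\mathcal Y)$ is the $\mathcal Y$-valued Hardy space on $\mathbb D$. $\mathcal U^N$ is the direct sum of $N$ copies of $\mathcal U$, and $\ell^2_+(\mathcal Y)$ is the Hilbert space of square summable sequences $(y_0,y_1,\ldots)$ in $\mathcal Y$. $\Pi_{\mathcal Y}$, $\Pi_{\mathcal U}$ are the projections of $\mathcal Y\oplus\mathcal U$ onto its summands, viewed as operators into these summands. $\mathbf S(\mathcal U,\mathcal Y)$ (Schur class) is the set of analytic functions on $\mathbb D$ whose values are contractions from $\mathcal U$ to $\mathcal Y$. $\mathbf H^2(\mathcal U,\mathcal Y)$ is the set of functions $F$ on $\mathbb D$ with values bounded operators from $\mathcal U$ to $\mathcal Y$ such that $\lambda\mapsto F(\lambda)u$ is in $H^2(\mathcal Y)$ for each $u\in\mathcal U$. *)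

theory Defs
  imports "HOL-Analysis.Analysis"
begin

section \<open>Complex normed spaces and complex Hilbert spaces\<close>

class scaleC =
  fixes scaleC :: "complex \<Rightarrow> 'a \<Rightarrow> 'a"  (infixr \<open>*\<^sub>C\<close> 75)

text \<open>The axiom \<open>scaleR_scaleC\<close> makes the complex structure extend the real one, and in particular
  gives \<open>1 *\<^sub>C x = x\<close>.\<close>

class complex_normed_vector = real_normed_vector + scaleC +
  assumes scaleC_add_right: "c *\<^sub>C (x + y) = c *\<^sub>C x + c *\<^sub>C y"
    and scaleC_add_left: "(c + d) *\<^sub>C x = c *\<^sub>C x + d *\<^sub>C x"
    and scaleC_scaleC: "c *\<^sub>C (d *\<^sub>C x) = (c * d) *\<^sub>C x"
    and scaleR_scaleC: "r *\<^sub>R x = complex_of_real r *\<^sub>C x"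
    and norm_scaleC: "norm (c *\<^sub>C x) = cmod c * norm x"

text \<open>The inner product \<open>cinner\<close> is linear in its first argument. Its real part is the inner product
  of \<^class>\<open>real_inner\<close>, so that the norm is the one induced by \<open>cinner\<close> and \<open>cinner\<close> is positive
  definite.\<close>

class complex_hilbert_space = complex_normed_vector + real_inner + complete_space +
  fixes cinner :: "'a \<Rightarrow> 'a \<Rightarrow> complex"
  assumes cinner_commute: "cinner x y = cnj (cinner y x)"
    and cinner_add_left: "cinner (x + y) z = cinner x z + cinner y z"
    and cinner_scaleC_left: "cinner (c *\<^sub>C x) y = c * cinner x y"
    and Re_cinner: "Re (cinner x y) = inner x y"

instance complex_hilbert_space \<subseteq> banach ..

instantiation complex :: complex_hilbert_space
begin

definition scaleC_complex :: "complex \<Rightarrow> complex \<Rightarrow> complex"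
  where "scaleC_complex c x = c * x"

definition cinner_complex :: "complex \<Rightarrow> complex \<Rightarrow> complex"
  where "cinner_complex x y = x * cnj y"

instance
  by standard (auto simp: scaleC_complex_def cinner_complex_def algebra_simps norm_mult
      scaleR_conv_of_real inner_complex_def)

end

instantiation prod :: (complex_normed_vector, complex_normed_vector) complex_normed_vector
begin

definition scaleC_prod :: "complex \<Rightarrow> 'a \<times> 'b \<Rightarrow> 'a \<times> 'b"
  where "scaleC_prod c x = (c *\<^sub>C fst x, c *\<^sub>C snd x)"

instance
proof
  fix c d :: complex and r :: real and x y :: "'a \<times> 'b"
  show "c *\<^sub>C (x + y) = c *\<^sub>C x + c *\<^sub>C y"
    by (simp add: scaleC_prod_def scaleC_add_right)
  show "(c + d) *\<^sub>C x = c *\<^sub>C x + d *\<^sub>C x"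
    by (simp add: scaleC_prod_def scaleC_add_left)
  show "c *\<^sub>C (d *\<^sub>C x) = (c * d) *\<^sub>C x"
    by (simp add: scaleC_prod_def scaleC_scaleC)
  show "r *\<^sub>R x = complex_of_real r *\<^sub>C x"
    by (simp add: scaleC_prod_def scaleR_prod_def scaleR_scaleC)
  have "sqrt ((cmod c)\<^sup>2 * (norm (fst x))\<^sup>2 + (cmod c)\<^sup>2 * (norm (snd x))\<^sup>2)
      = cmod c * sqrt ((norm (fst x))\<^sup>2 + (norm (snd x))\<^sup>2)"
    by (simp flip: distrib_left add: real_sqrt_mult)
  then show "norm (c *\<^sub>C x) = cmod c * norm x"
    by (simp add: scaleC_prod_def norm_prod_def norm_scaleC power_mult_distrib)
qed

end

text \<open>The Hilbert space direct sum of \<open>'a\<close> and \<open>'b\<close> is the type \<open>'a \<times> 'b\<close>.\<close>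

instantiation prod :: (complex_hilbert_space, complex_hilbert_space) complex_hilbert_space
begin

definition cinner_prod :: "'a \<times> 'b \<Rightarrow> 'a \<times> 'b \<Rightarrow> complex"
  where "cinner_prod x y = cinner (fst x) (fst y) + cinner (snd x) (snd y)"

instance
proof
  fix c :: complex and x y z :: "'a \<times> 'b"
  show "cinner x y = cnj (cinner y x)"
    by (simp add: cinner_prod_def cinner_commute[of "fst x"] cinner_commute[of "snd x"])
  show "cinner (x + y) z = cinner x z + cinner y z"
    by (simp add: cinner_prod_def cinner_add_left)
  show "cinner (c *\<^sub>C x) y = c * cinner x y"
    by (simp add: cinner_prod_def scaleC_prod_def cinner_scaleC_left algebra_simps)
  show "Re (cinner x y) = inner x y"
    by (simp add: cinner_prod_def Re_cinner inner_prod_def)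
qed

end


section \<open>Bounded operators\<close>

text \<open>The type \<open>'a \<Rightarrow>\<^sub>L 'b\<close> consists of the real-linear bounded maps; it is a complex normed space under
  scaling in the codomain. The bounded operators between complex spaces are those elements that
  satisfy \<open>complex_linear\<close>.\<close>

lemma bounded_linear_scaleC_right: "bounded_linear (\<lambda>x::'a::complex_normed_vector. c *\<^sub>C x)"
  by (rule bounded_linear_intro[where K = "cmod c"])
     (simp_all add: scaleC_add_right scaleR_scaleC scaleC_scaleC norm_scaleC mult.commute)

definition complex_linear :: "('a::complex_normed_vector \<Rightarrow>\<^sub>L 'b::complex_normed_vector) \<Rightarrow> bool"
  where "complex_linear A \<longleftrightarrow> (\<forall>c x. blinfun_apply A (c *\<^sub>C x) = c *\<^sub>C blinfun_apply A x)"

instantiation blinfun :: (real_normed_vector, complex_normed_vector) complex_normed_vector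
begin

lift_definition scaleC_blinfun :: "complex \<Rightarrow> ('a \<Rightarrow>\<^sub>L 'b) \<Rightarrow> ('a \<Rightarrow>\<^sub>L 'b)"
  is "\<lambda>c A x. c *\<^sub>C A x"
  by (rule bounded_linear_compose[OF bounded_linear_scaleC_right])

instance
proof
  have add_right: "c *\<^sub>C (A + B) = c *\<^sub>C A + c *\<^sub>C B" for c and A B :: "'a \<Rightarrow>\<^sub>L 'b"
    by transfer (simp add: scaleC_add_right)
  have add_left: "(c + d) *\<^sub>C A = c *\<^sub>C A + d *\<^sub>C A" for c d and A :: "'a \<Rightarrow>\<^sub>L 'b"
    by transfer (simp add: scaleC_add_left)
  have assoc: "c *\<^sub>C (d *\<^sub>C A) = (c * d) *\<^sub>C A" for c d and A :: "'a \<Rightarrow>\<^sub>L 'b"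
    by transfer (simp add: scaleC_scaleC)
  have real: "r *\<^sub>R A = complex_of_real r *\<^sub>C A" for r and A :: "'a \<Rightarrow>\<^sub>L 'b"
    by transfer (simp add: scaleR_scaleC)
  fix c d :: complex and r :: real and A B :: "'a \<Rightarrow>\<^sub>L 'b"
  show "c *\<^sub>C (A + B) = c *\<^sub>C A + c *\<^sub>C B" by (rule add_right)
  show "(c + d) *\<^sub>C A = c *\<^sub>C A + d *\<^sub>C A" by (rule add_left)
  show "c *\<^sub>C (d *\<^sub>C A) = (c * d) *\<^sub>C A" by (rule assoc)
  show "r *\<^sub>R A = complex_of_real r *\<^sub>C A" by (rule real)
  have le: "norm (e *\<^sub>C D) \<le> cmod e * norm D" for e and D :: "'a \<Rightarrow>\<^sub>L 'b"
  proof (rule norm_blinfun_bound)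
    fix x
    have "cmod e * norm (blinfun_apply D x) \<le> cmod e * (norm D * norm x)"
      by (intro mult_left_mono norm_blinfun) simp
    then show "norm (blinfun_apply (e *\<^sub>C D) x) \<le> cmod e * norm D * norm x"
      by (simp add: scaleC_blinfun.rep_eq norm_scaleC)
  qed simp
  show "norm (c *\<^sub>C A) = cmod c * norm A"
  proof (cases "c = 0")
    case True
    then show ?thesis using le[of c A] by simp
  next
    case False
    have "inverse c *\<^sub>C (c *\<^sub>C A) = A"
      using False real[of 1 A] by (simp add: assoc)
    then have "norm A \<le> cmod (inverse c) * norm (c *\<^sub>C A)"
      using le[of "inverse c" "c *\<^sub>C A"] by simp
    then have "cmod c * norm A \<le> norm (c *\<^sub>C A)"
      using False by (simp add: norm_inverse norm_divide field_simps)
    then show ?thesis using le[of c A] by simp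
  qed
qed

end

text \<open>The two-sided inverse, which is unique when it exists.\<close>

definition blinfun_inverse :: "('a::real_normed_vector \<Rightarrow>\<^sub>L 'a) \<Rightarrow> ('a \<Rightarrow>\<^sub>L 'a)"
  where "blinfun_inverse A = (THE B. B o\<^sub>L A = id_blinfun \<and> A o\<^sub>L B = id_blinfun)"


section \<open>Analytic functions on the unit disc\<close>

abbreviation unit_disc :: "complex set"  (\<open>\<bbbD>\<close>)
  where "\<bbbD> \<equiv> ball 0 1"

text \<open>Complex differentiability in norm; for operator-valued functions the norm is the operator
  norm. For complex-valued functions this is \<^const>\<open>holomorphic_on\<close>.\<close>

definition cholomorphic_on :: "(complex \<Rightarrow> 'a::complex_normed_vector) \<Rightarrow> complex set \<Rightarrow> bool"
    (infixl \<open>cholomorphic'_on\<close> 50)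
  where "f cholomorphic_on S \<longleftrightarrow>
    (\<forall>z\<in>S. \<exists>f'. (f has_derivative (\<lambda>h. h *\<^sub>C f')) (at z within S))"

lemma cholomorphic_on_complex_iff:
  fixes f :: "complex \<Rightarrow> complex"
  shows "f cholomorphic_on S \<longleftrightarrow> f holomorphic_on S"
  by (simp add: cholomorphic_on_def holomorphic_on_def field_differentiable_def
      has_field_derivative_def scaleC_complex_def mult.commute[of _ "_::complex"])

definition hardy2 :: "(complex \<Rightarrow> 'y::complex_hilbert_space) set"
  where "hardy2 = {f. f cholomorphic_on \<bbbD> \<and>
    bdd_above ((\<lambda>r. 1 / (2 * pi) *
      integral {0..2 * pi} (\<lambda>t. (norm (f (complex_of_real r * cis t)))\<^sup>2)) ` {0..<1})}"

text \<open>The space \<open>\<^bold>H\<^sup>2(\<U>, \<Y>)\<close>, with \<open>\<U>\<close> and \<open>\<Y>\<close> given by the types \<open>'u\<close> and \<open>'y\<close>. Functions on the disc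
  are represented by total functions whose values outside the disc play no role.\<close>

definition operator_hardy2 ::
    "(complex \<Rightarrow> 'u::complex_hilbert_space \<Rightarrow>\<^sub>L 'y::complex_hilbert_space) set"
  where "operator_hardy2 = {F. (\<forall>z\<in>\<bbbD>. complex_linear (F z)) \<and>
    (\<forall>u. (\<lambda>z. blinfun_apply (F z) u) \<in> hardy2)}"

definition schur_class ::
    "(complex \<Rightarrow> 'u::complex_hilbert_space \<Rightarrow>\<^sub>L 'y::complex_hilbert_space) set"
  where "schur_class = {F. F cholomorphic_on \<bbbD> \<and>
    (\<forall>z\<in>\<bbbD>. complex_linear (F z) \<and> norm (F z) \<le> 1)}"

text \<open>The expansion is required to converge in the strong operator topology, matching the pointwise
  nature of \<^const>\<open>operator_hardy2\<close>; this already determines the coefficients.\<close>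

definition taylor_coeffs_at_0 ::
    "(complex \<Rightarrow> 'u::complex_hilbert_space \<Rightarrow>\<^sub>L 'y::complex_hilbert_space) \<Rightarrow>
      (nat \<Rightarrow> 'u \<Rightarrow>\<^sub>L 'y) \<Rightarrow> bool"
  where "taylor_coeffs_at_0 F A \<longleftrightarrow>
    (\<forall>z\<in>\<bbbD>. \<forall>u. (\<lambda>n. z ^ n *\<^sub>C blinfun_apply (A n) u) sums blinfun_apply (F z) u)"


section \<open>Square summable sequences and the block Toeplitz operator\<close>

definition l2_seq :: "(nat \<Rightarrow> 'y::complex_hilbert_space) set"
  where "l2_seq = {y. summable (\<lambda>m. (norm (y m))\<^sup>2)}"

definition l2_norm :: "(nat \<Rightarrow> 'y::complex_hilbert_space) \<Rightarrow> real"
  where "l2_norm y = sqrt (\<Sum>m. (norm (y m))\<^sup>2)"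

text \<open>An element of \<open>\<U>\<^sup>N\<close> is given by the entries \<open>u 0, \<dots>, u (N - 1)\<close> of a function \<open>u\<close> on the natural
  numbers; the other values of \<open>u\<close> are irrelevant. Columns are thus numbered from 0.\<close>

definition direct_sum_norm :: "nat \<Rightarrow> (nat \<Rightarrow> 'u::complex_hilbert_space) \<Rightarrow> real"
  where "direct_sum_norm N u = L2_set (\<lambda>j. norm (u j)) {..<N}"

definition block_toeplitz ::
    "nat \<Rightarrow> (nat \<Rightarrow> 'u::complex_hilbert_space \<Rightarrow>\<^sub>L 'y::complex_hilbert_space) \<Rightarrow>
      (nat \<Rightarrow> 'u) \<Rightarrow> (nat \<Rightarrow> 'y)"
  where "block_toeplitz N A u =
    (\<lambda>m. \<Sum>j<N. if j \<le> m then blinfun_apply (A (m - j)) (u j) else 0)"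

text \<open>For a linear map \<open>T\<close> that depends on the first \<open>N\<close> entries of its argument only: \<open>T\<close> is a contraction
  from \<open>\<U>\<^sup>N\<close> to the space of square summable sequences.\<close>

definition contraction_to_l2 ::
    "nat \<Rightarrow> ((nat \<Rightarrow> 'u::complex_hilbert_space) \<Rightarrow> (nat \<Rightarrow> 'y::complex_hilbert_space)) \<Rightarrow> bool"
  where "contraction_to_l2 N T \<longleftrightarrow> (\<forall>u. T u \<in> l2_seq \<and> l2_norm (T u) \<le> direct_sum_norm N u)"

end

theory Submission
  imports Defs "HOL-Complex_Analysis.Complex_Analysis"
begin

text \<open>Sufficiency. For \<open>p(z) = \<Sum>j<N. z\<^sup>j u\<^sub>j\<close> put \<open>g = (I - z\<^sup>N \<Pi>\<^sub>U V)\<^sup>-\<^sup>1 p\<close> and \<open>f = \<Pi>\<^sub>U V g\<close>, so that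
  \<open>V g = (H p, f)\<close> and \<open>g = p + z\<^sup>N f\<close>. On a circle of radius \<open>r < 1\<close> the terms \<open>p\<close> and \<open>z\<^sup>N f\<close> are
  orthogonal, whence \<open>\<parallel>H p\<parallel>\<^sup>2 + \<parallel>f\<parallel>\<^sup>2 \<le> \<parallel>g\<parallel>\<^sup>2 \<le> \<parallel>p\<parallel>\<^sup>2 + \<parallel>f\<parallel>\<^sup>2\<close>; now let \<open>r \<rightarrow> 1\<close>.

  Necessity. Let \<open>T\<close> be the Toeplitz contraction and \<open>D\<close> an operator with \<open>T\<^sup>*T + D\<^sup>*D = I\<close>. The Toeplitz
  structure makes \<open>D (0, u\<^sub>0, u\<^sub>1, \<dots>) \<mapsto> D (u\<^sub>0, u\<^sub>1, \<dots>)\<close> isometric. Together with the backward shift it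
  defines a contraction \<open>Z\<close> that moves the isometric embedding \<open>E\<^sub>j u = (T e\<^sub>j u, D e\<^sub>j u)\<close> to \<open>E\<^sub>j\<^sub>-\<^sub>1 u\<close>,
  and \<open>H\<^sub>n = C Z\<^sup>n E\<^sub>0\<close> with \<open>C\<close> the zeroth coordinate. So the \<open>E\<^sub>j\<close> form a delay line of length \<open>N\<close>;
  cutting it open, that is compressing \<open>Z\<close> to the orthogonal complement of their ranges, gives a
  contractive system whose transfer function is \<open>V\<close>.\<close>

section \<open>Operator-valued analytic functions\<close>

lemma bounded_bilinear_scaleC:
  "bounded_bilinear (\<lambda>c (x::'a::complex_normed_vector). c *\<^sub>C x)"
proof
  show "\<exists>K. \<forall>a (b::'a). norm (a *\<^sub>C b) \<le> norm a * norm b * K"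
    by (rule exI[of _ 1]) (simp add: norm_scaleC)
qed (simp_all add: scaleC_add_left scaleC_add_right scaleR_scaleC scaleC_scaleC
      scaleC_complex_def scaleR_conv_of_real mult.commute)

lemma scaleC_one [simp]: "1 *\<^sub>C x = (x::'a::complex_normed_vector)"
  using scaleR_scaleC[of 1 x] by simp

lemma scaleC_zero_left [simp]: "0 *\<^sub>C x = (0::'a::complex_normed_vector)"
  using scaleR_scaleC[of 0 x] by simp

lemmas scaleC_zero_right [simp] = bounded_bilinear.zero_right[OF bounded_bilinear_scaleC]
lemmas scaleC_diff_right = bounded_bilinear.diff_right[OF bounded_bilinear_scaleC]
lemmas scaleC_sum_right = bounded_bilinear.sum_right[OF bounded_bilinear_scaleC]
lemmas tendsto_scaleC = bounded_bilinear.tendsto[OF bounded_bilinear_scaleC]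
lemmas continuous_on_scaleC = bounded_bilinear.continuous_on[OF bounded_bilinear_scaleC]

lemma fst_scaleC [simp]: "fst (c *\<^sub>C x) = c *\<^sub>C fst x"
  and snd_scaleC [simp]: "snd (c *\<^sub>C x) = c *\<^sub>C snd x"
  by (simp_all add: scaleC_prod_def)

lemma cinner_scaleC_right: "cinner x (c *\<^sub>C y) = cnj c * cinner x y"
proof -
  have "cinner x (c *\<^sub>C y) = cnj (cinner (c *\<^sub>C y) x)"
    by (rule cinner_commute)
  also have "\<dots> = cnj c * cnj (cinner y x)"
    by (simp add: cinner_scaleC_left)
  also have "cnj (cinner y x) = cinner x y"
    by (rule cinner_commute[symmetric])
  finally show ?thesis .
qed

lemma inner_scaleC_left:
  "inner (c *\<^sub>C x) y = inner x (cnj c *\<^sub>C (y::'a::complex_hilbert_space))"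
proof -
  have "inner (c *\<^sub>C x) y = Re (cinner (c *\<^sub>C x) y)"
    by (simp add: Re_cinner)
  also have "\<dots> = Re (cinner x (cnj c *\<^sub>C y))"
    by (simp add: cinner_scaleC_left cinner_scaleC_right)
  finally show ?thesis by (simp add: Re_cinner)
qed

text \<open>\<open>cinner\<close> is conjugate linear in its second argument, so pairing with
  \<open>\<i> *\<^sub>C y\<close> multiplies by \<open>- \<i>\<close> and turns the imaginary part
  into a real part. Boundedness and summability of \<open>cinner\<close> thus reduce to
  \<open>inner\<close>.\<close>

lemma cinner_eq_Complex: "cinner x y = Complex (inner x y) (inner x (\<i> *\<^sub>C y))"
  by (rule complex_eqI) (simp_all add: Re_cinner cinner_scaleC_right flip: Re_cinner)

lemma bounded_linear_cinner_left: "bounded_linear (\<lambda>x. cinner x y)"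
proof -
  have "(\<lambda>x. cinner x y) = (\<lambda>x. of_real (inner x y) + \<i> * of_real (inner x (\<i> *\<^sub>C y)))"
    by (simp add: cinner_eq_Complex complex_eq_iff fun_eq_iff)
  moreover have "bounded_linear \<dots>"
    by (intro bounded_linear_add bounded_linear_compose[OF bounded_linear_mult_right]
        bounded_linear_compose[OF bounded_linear_of_real] bounded_linear_inner_left)
  ultimately show ?thesis by simp
qed

lemma complex_linearD: "complex_linear A \<Longrightarrow> A (c *\<^sub>C x) = c *\<^sub>C A x"
  by (simp add: complex_linear_def)

lemma complex_linear_compose: "complex_linear A \<Longrightarrow> complex_linear B \<Longrightarrow> complex_linear (A o\<^sub>L B)"
  by (simp add: complex_linear_def)

lemma complex_linear_id: "complex_linear id_blinfun"
  by (simp add: complex_linear_def)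

lemma complex_linear_diff: "complex_linear A \<Longrightarrow> complex_linear B \<Longrightarrow> complex_linear (A - B)"
  by (simp add: complex_linear_def blinfun.diff_left scaleC_diff_right)

lemma complex_linear_scaleC: "complex_linear A \<Longrightarrow> complex_linear (c *\<^sub>C A)"
  by (simp add: complex_linear_def scaleC_blinfun.rep_eq scaleC_scaleC mult.commute)

lemma complex_linear_fst: "complex_linear fst_blinfun"
  and complex_linear_snd: "complex_linear snd_blinfun"
  by (simp_all add: complex_linear_def)

lemma blinfun_compose_scaleC_left: "(c *\<^sub>C A) o\<^sub>L B = c *\<^sub>C (A o\<^sub>L B)"
  by (rule blinfun_eqI) (simp add: scaleC_blinfun.rep_eq)

lemma blinfun_compose_scaleC_right: "complex_linear A \<Longrightarrow> A o\<^sub>L (c *\<^sub>C B) = c *\<^sub>C (A o\<^sub>L B)"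
  by (rule blinfun_eqI) (simp add: scaleC_blinfun.rep_eq complex_linearD)

lemma norm_blinfun_le_1D:
  assumes "norm A \<le> 1" shows "norm (blinfun_apply A x) \<le> norm x"
  using norm_blinfun[of A x] mult_right_mono[OF assms, of "norm x"] by simp

section \<open>Complex differentiability through difference quotients\<close>

lemma has_derivative_scaleC_iff:
  fixes f :: "complex \<Rightarrow> 'a::complex_normed_vector"
  shows "(f has_derivative (\<lambda>h. h *\<^sub>C f')) (at a within S) \<longleftrightarrow>
    ((\<lambda>z. inverse (z - a) *\<^sub>C (f z - f a)) \<longlongrightarrow> f') (at a within S)"
proof -
  have bl: "bounded_linear (\<lambda>h::complex. h *\<^sub>C f')"
    by (rule bounded_bilinear.bounded_linear_left[OF bounded_bilinear_scaleC])
  \<comment> \<open>Dividing the remainder by \<open>z - a\<close> instead of its modulus changes it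
    by a factor of modulus 1 only.\<close>
  have eq: "norm (inverse (norm (z - a)) *\<^sub>R (f z - f a - (z - a) *\<^sub>C f'))
      = norm (inverse (z - a) *\<^sub>C (f z - f a) - f')" if "z \<noteq> a" for z
  proof -
    have "f' = inverse (z - a) *\<^sub>C ((z - a) *\<^sub>C f')"
      using that by (simp add: scaleC_scaleC)
    then have "inverse (z - a) *\<^sub>C (f z - f a) - f'
        = inverse (z - a) *\<^sub>C (f z - f a - (z - a) *\<^sub>C f')"
      by (simp only: scaleC_diff_right)
    then show ?thesis by (simp add: norm_scaleC norm_inverse)
  qed
  have "(f has_derivative (\<lambda>h. h *\<^sub>C f')) (at a within S) \<longleftrightarrow>
    ((\<lambda>z. inverse (norm (z - a)) *\<^sub>R (f z - f a - (z - a) *\<^sub>C f')) \<longlongrightarrow> 0) (at a within S)"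
    by (simp add: has_derivative_at_within bl)
  also have "\<dots> \<longleftrightarrow>
    ((\<lambda>z. norm (inverse (norm (z - a)) *\<^sub>R (f z - f a - (z - a) *\<^sub>C f'))) \<longlongrightarrow> 0) (at a within S)"
    by (rule tendsto_norm_zero_iff[symmetric])
  also have "\<dots> \<longleftrightarrow>
    ((\<lambda>z. norm (inverse (z - a) *\<^sub>C (f z - f a) - f')) \<longlongrightarrow> 0) (at a within S)"
    by (intro tendsto_cong) (unfold eventually_at_filter, intro always_eventually allI impI eq)
  also have "\<dots> \<longleftrightarrow> ((\<lambda>z. inverse (z - a) *\<^sub>C (f z - f a)) \<longlongrightarrow> f') (at a within S)"
    by (simp only: tendsto_norm_zero_iff Lim_null[symmetric])
  finally show ?thesis .
qed

lemma cholomorphic_on_iff_tendsto: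
  "f cholomorphic_on S \<longleftrightarrow>
    (\<forall>a\<in>S. \<exists>f'. ((\<lambda>z. inverse (z - a) *\<^sub>C (f z - f a)) \<longlongrightarrow> f') (at a within S))"
  by (simp add: cholomorphic_on_def has_derivative_scaleC_iff)

lemma cholomorphic_on_imp_continuous_on:
  "f cholomorphic_on S \<Longrightarrow> continuous_on S f"
  unfolding cholomorphic_on_def continuous_on_eq_continuous_within
  using has_derivative_continuous by blast

text \<open>The usual product rule. Homogeneity in the second argument is asked only at the values
  \<open>f z\<close>: the operator types contain merely real-linear maps, so complex linearity is a
  property of each single operator.\<close>

lemma cholomorphic_on_bilinear:
  fixes prod :: "'a::complex_normed_vector \<Rightarrow> 'b::complex_normed_vector \<Rightarrow> 'c::complex_normed_vector"
  assumes bil: "bounded_bilinear prod"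
    and f: "f cholomorphic_on S" and g: "g cholomorphic_on S"
    and left: "\<And>c x y. prod (c *\<^sub>C x) y = c *\<^sub>C prod x y"
    and right: "\<And>z c y. z \<in> S \<Longrightarrow> prod (f z) (c *\<^sub>C y) = c *\<^sub>C prod (f z) y"
  shows "(\<lambda>z. prod (f z) (g z)) cholomorphic_on S"
  unfolding cholomorphic_on_iff_tendsto
proof
  fix a assume a: "a \<in> S"
  obtain f' g' where f': "((\<lambda>z. inverse (z - a) *\<^sub>C (f z - f a)) \<longlongrightarrow> f') (at a within S)"
    and g': "((\<lambda>z. inverse (z - a) *\<^sub>C (g z - g a)) \<longlongrightarrow> g') (at a within S)"
    using f g a unfolding cholomorphic_on_iff_tendsto by blast
  have cont: "(f \<longlongrightarrow> f a) (at a within S)"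
    using cholomorphic_on_imp_continuous_on[OF f] a by (simp add: continuous_on_def)
  interpret bounded_bilinear prod by fact
  \<comment> \<open>The second summand carries \<open>f z\<close>, not \<open>f a\<close>, so that
    the two differences telescope exactly.\<close>
  have "((\<lambda>z. prod (inverse (z - a) *\<^sub>C (f z - f a)) (g a)
      + prod (f z) (inverse (z - a) *\<^sub>C (g z - g a))) \<longlongrightarrow> prod f' (g a) + prod (f a) g') (at a within S)"
    by (intro tendsto_add tendsto f' g' cont tendsto_const)
  moreover have "eventually (\<lambda>z. prod (inverse (z - a) *\<^sub>C (f z - f a)) (g a)
      + prod (f z) (inverse (z - a) *\<^sub>C (g z - g a))
      = inverse (z - a) *\<^sub>C (prod (f z) (g z) - prod (f a) (g a))) (at a within S)"
    unfolding eventually_at_filter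
    by (rule always_eventually)
       (auto simp: left right diff_left diff_right simp flip: scaleC_add_right)
  ultimately show "\<exists>l. ((\<lambda>z. inverse (z - a) *\<^sub>C (prod (f z) (g z) - prod (f a) (g a))) \<longlongrightarrow> l)
      (at a within S)"
    by (blast intro: Lim_transform_eventually)
qed

lemma cholomorphic_on_const: "(\<lambda>z. c) cholomorphic_on S"
  unfolding cholomorphic_on_iff_tendsto by auto

lemma cholomorphic_on_add:
  assumes f: "f cholomorphic_on S" and g: "g cholomorphic_on S"
  shows "(\<lambda>z. f z + g z) cholomorphic_on S"
  unfolding cholomorphic_on_iff_tendsto
proof
  fix a assume a: "a \<in> S"
  obtain f' g' where "((\<lambda>z. inverse (z - a) *\<^sub>C (f z - f a)) \<longlongrightarrow> f') (at a within S)"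
    and "((\<lambda>z. inverse (z - a) *\<^sub>C (g z - g a)) \<longlongrightarrow> g') (at a within S)"
    using f g a unfolding cholomorphic_on_iff_tendsto by blast
  then have "((\<lambda>z. inverse (z - a) *\<^sub>C (f z + g z - (f a + g a))) \<longlongrightarrow> f' + g') (at a within S)"
    using tendsto_add by (fastforce simp: add_diff_add scaleC_add_right)
  then show "\<exists>l. ((\<lambda>z. inverse (z - a) *\<^sub>C (f z + g z - (f a + g a))) \<longlongrightarrow> l) (at a within S)" ..
qed

lemma cholomorphic_on_sum:
  "(\<And>i. i \<in> A \<Longrightarrow> f i cholomorphic_on S) \<Longrightarrow> (\<lambda>z. \<Sum>i\<in>A. f i z) cholomorphic_on S"
  by (induction A rule: infinite_finite_induct)
     (simp_all add: cholomorphic_on_const cholomorphic_on_add)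

lemma cholomorphic_on_scaleC:
  assumes f: "f holomorphic_on S" and g: "g cholomorphic_on S"
  shows "(\<lambda>z. f z *\<^sub>C g z) cholomorphic_on S"
  using f g by (intro cholomorphic_on_bilinear[OF bounded_bilinear_scaleC])
    (simp_all add: cholomorphic_on_complex_iff scaleC_scaleC scaleC_complex_def mult.commute)

lemma cholomorphic_on_blinfun_apply:
  assumes "F cholomorphic_on S" "g cholomorphic_on S" "\<And>z. z \<in> S \<Longrightarrow> complex_linear (F z)"
  shows "(\<lambda>z. blinfun_apply (F z) (g z)) cholomorphic_on S"
  using assms by (intro cholomorphic_on_bilinear[OF bounded_bilinear_blinfun_apply])
    (simp_all add: scaleC_blinfun.rep_eq complex_linearD)

lemma cholomorphic_on_blinfun_compose:
  assumes "F cholomorphic_on S" "G cholomorphic_on S" "\<And>z. z \<in> S \<Longrightarrow> complex_linear (F z)"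
  shows "(\<lambda>z. F z o\<^sub>L G z) cholomorphic_on S"
  using assms by (intro cholomorphic_on_bilinear[OF bounded_bilinear_blinfun_compose])
    (simp_all add: blinfun_compose_scaleC_left blinfun_compose_scaleC_right)

text \<open>Passage to scalar functions, to which Cauchy's formula applies.\<close>

lemma cholomorphic_on_cinner:
  assumes "f cholomorphic_on S"
  shows "(\<lambda>z. cinner (f z) a) holomorphic_on S"
proof -
  define A where "A = Blinfun (\<lambda>x. cinner x a)"
  have A: "blinfun_apply A x = cinner x a" for x
    by (simp add: A_def bounded_linear_Blinfun_apply bounded_linear_cinner_left)
  have "(\<lambda>z. blinfun_apply A (f z)) cholomorphic_on S"
    by (rule cholomorphic_on_blinfun_apply[OF cholomorphic_on_const assms])
       (simp add: complex_linear_def A cinner_scaleC_left scaleC_complex_def)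
  then show ?thesis by (simp add: A cholomorphic_on_complex_iff)
qed

section \<open>Inverting the identity minus a strict contraction\<close>

lemma bij_id_minus_contraction:
  fixes W :: "'a::banach \<Rightarrow>\<^sub>L 'a"
  assumes W: "norm W < 1"
  shows "\<exists>!x. x - W x = y"
proof -
  \<comment> \<open>The solutions of \<open>x - W x = y\<close> are the fixed points of a strict
    contraction, so Banach's fixed point theorem applies.\<close>
  have "\<exists>!x. (\<lambda>x. y + W x) x = x"
  proof (rule banach_fix_type)
    show "\<forall>x z. dist (y + W x) (y + W z) \<le> norm W * dist x z"
    proof (intro allI)
      fix x z
      show "dist (y + W x) (y + W z) \<le> norm W * dist x z"
        using norm_blinfun[of W "x - z"] by (simp add: dist_norm blinfun.diff_right)
    qed
  qed (use W in auto)
  moreover have "(\<lambda>x. y + W x) x = x \<longleftrightarrow> x - W x = y" for x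
    by (metis add_diff_cancel_right' diff_add_cancel)
  ultimately show ?thesis by simp
qed

lemma norm_le_norm_id_minus:
  fixes W :: "'a::real_normed_vector \<Rightarrow>\<^sub>L 'a"
  shows "(1 - norm W) * norm x \<le> norm (x - W x)"
  using norm_blinfun[of W x] norm_triangle_ineq2[of x "W x"] by (simp add: algebra_simps)

lemma blinfun_inverse_eqI:
  assumes "B o\<^sub>L A = id_blinfun" "A o\<^sub>L B = id_blinfun"
  shows "blinfun_inverse A = B"
  unfolding blinfun_inverse_def
proof (rule the_equality)
  fix B' assume "B' o\<^sub>L A = id_blinfun \<and> A o\<^sub>L B' = id_blinfun"
  then have B': "B' o\<^sub>L A = id_blinfun" by simp
  show "B' = B"
  proof (rule blinfun_eqI)
    fix x
    have "B' x = B' (A (B x))"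
      using assms(2) by (metis blinfun_apply_blinfun_compose blinfun_apply_id_blinfun id_apply)
    then show "B' x = B x"
      using B' by (metis blinfun_apply_blinfun_compose blinfun_apply_id_blinfun id_apply)
  qed
qed (use assms in simp)

text \<open>The inverse is the solution map of \<open>x - W x = y\<close>: unique solvability makes
  it linear, and the lower bound \<open>norm_le_norm_id_minus\<close> bounds it.\<close>

lemma
  fixes W :: "'a::banach \<Rightarrow>\<^sub>L 'a"
  assumes W: "norm W < 1"
  shows blinfun_inverse_left: "blinfun_inverse (id_blinfun - W) o\<^sub>L (id_blinfun - W) = id_blinfun"
    and blinfun_inverse_right: "(id_blinfun - W) o\<^sub>L blinfun_inverse (id_blinfun - W) = id_blinfun"
    and norm_blinfun_inverse_le: "norm (blinfun_inverse (id_blinfun - W)) \<le> inverse (1 - norm W)"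
proof -
  define g where "g y = (THE x. x - W x = y)" for y
  have g: "g y - W (g y) = y" for y
    unfolding g_def by (rule theI'[OF bij_id_minus_contraction[OF W]])
  have g_eq: "g y = x" if "x - W x = y" for x y
    using g[of y] that bij_id_minus_contraction[OF W, of y] by blast
  have g_norm: "norm (g y) \<le> norm y * inverse (1 - norm W)" for y
    using norm_le_norm_id_minus[of W "g y"] W by (simp add: g field_simps)
  have "bounded_linear g"
  proof (rule bounded_linear_intro[OF _ _ g_norm])
    show "g (x + y) = g x + g y" for x y
      by (rule g_eq) (simp only: blinfun.add_right add_diff_add g)
    show "g (r *\<^sub>R x) = r *\<^sub>R g x" for r x
      by (rule g_eq) (simp only: blinfun.scaleR_right scaleR_diff_right[symmetric] g)
  qed
  then have ap: "blinfun_apply (Blinfun g) y = g y" for y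
    by (simp add: bounded_linear_Blinfun_apply)
  have l: "Blinfun g o\<^sub>L (id_blinfun - W) = id_blinfun"
    by (rule blinfun_eqI) (simp add: ap blinfun.diff_left g_eq)
  have r: "(id_blinfun - W) o\<^sub>L Blinfun g = id_blinfun"
    by (rule blinfun_eqI) (simp add: ap blinfun.diff_left g)
  have eq: "blinfun_inverse (id_blinfun - W) = Blinfun g"
    using l r by (rule blinfun_inverse_eqI)
  show "blinfun_inverse (id_blinfun - W) o\<^sub>L (id_blinfun - W) = id_blinfun"
    and "(id_blinfun - W) o\<^sub>L blinfun_inverse (id_blinfun - W) = id_blinfun"
    using l r by (simp_all add: eq)
  show "norm (blinfun_inverse (id_blinfun - W)) \<le> inverse (1 - norm W)"
    using g_norm W by (intro norm_blinfun_bound) (simp_all add: eq ap mult.commute)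
qed

lemma
  fixes W :: "'a::banach \<Rightarrow>\<^sub>L 'a"
  assumes W: "norm W < 1"
  shows blinfun_inverse_fixpoint:
      "blinfun_inverse (id_blinfun - W) x - W (blinfun_inverse (id_blinfun - W) x) = x"
    and blinfun_inverse_cancel: "blinfun_inverse (id_blinfun - W) (x - W x) = x"
proof -
  have "(id_blinfun - W) (blinfun_inverse (id_blinfun - W) x) = x"
    using blinfun_inverse_right[OF W]
    by (metis blinfun_apply_blinfun_compose blinfun_apply_id_blinfun id_apply)
  then show "blinfun_inverse (id_blinfun - W) x - W (blinfun_inverse (id_blinfun - W) x) = x"
    by (simp add: blinfun.diff_left)
  have "blinfun_inverse (id_blinfun - W) ((id_blinfun - W) x) = x"
    using blinfun_inverse_left[OF W]
    by (metis blinfun_apply_blinfun_compose blinfun_apply_id_blinfun id_apply)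
  then show "blinfun_inverse (id_blinfun - W) (x - W x) = x"
    by (simp add: blinfun.diff_left)
qed

lemma complex_linear_blinfun_inverse:
  fixes W :: "'a::complex_hilbert_space \<Rightarrow>\<^sub>L 'a"
  assumes W: "norm W < 1" and lin: "complex_linear W"
  shows "complex_linear (blinfun_inverse (id_blinfun - W))"
  unfolding complex_linear_def
proof (intro allI)
  fix c x
  let ?R = "blinfun_inverse (id_blinfun - W)"
  have "c *\<^sub>C ?R x - W (c *\<^sub>C ?R x) = c *\<^sub>C x"
    by (simp only: complex_linearD[OF lin] scaleC_diff_right[symmetric] blinfun_inverse_fixpoint[OF W])
  then have "?R (c *\<^sub>C x) = ?R (c *\<^sub>C ?R x - W (c *\<^sub>C ?R x))"
    by simp
  then show "?R (c *\<^sub>C x) = c *\<^sub>C ?R x"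
    by (simp add: blinfun_inverse_cancel[OF W])
qed

text \<open>The resolvent identity \<open>R z - R a = R z (W z - W a) R a\<close> first gives
  continuity of \<open>R\<close> and then, after division by \<open>z - a\<close>, the derivative
  \<open>R a W' R a\<close>.\<close>

lemma cholomorphic_on_blinfun_inverse:
  fixes W :: "complex \<Rightarrow> 'a::complex_hilbert_space \<Rightarrow>\<^sub>L 'a"
  assumes hol: "W cholomorphic_on S"
    and W: "\<And>z. z \<in> S \<Longrightarrow> norm (W z) < 1" and lin: "\<And>z. z \<in> S \<Longrightarrow> complex_linear (W z)"
  shows "(\<lambda>z. blinfun_inverse (id_blinfun - W z)) cholomorphic_on S"
  unfolding cholomorphic_on_iff_tendsto
proof
  fix a assume a: "a \<in> S"
  define R where "R z = blinfun_inverse (id_blinfun - W z)" for z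
  obtain W' where W': "((\<lambda>z. inverse (z - a) *\<^sub>C (W z - W a)) \<longlongrightarrow> W') (at a within S)"
    using hol a unfolding cholomorphic_on_iff_tendsto by blast
  have W_lim: "(W \<longlongrightarrow> W a) (at a within S)"
    using cholomorphic_on_imp_continuous_on[OF hol] a by (simp add: continuous_on_def)
  have diff: "R z - R a = R z o\<^sub>L (W z - W a) o\<^sub>L R a" if z: "z \<in> S" for z
  proof (rule blinfun_eqI)
    fix x
    have "R z (R a x - W a (R a x)) = R z x"
      by (simp only: R_def blinfun_inverse_fixpoint[OF W[OF a]])
    then have "R z x = R z (R a x - W z (R a x) + (W z - W a) (R a x))"
      by (simp add: blinfun.diff_left)
    also have "\<dots> = R a x + R z ((W z - W a) (R a x))"
      unfolding blinfun.add_right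
      by (simp add: R_def blinfun_inverse_cancel[OF W[OF z]])
    finally show "(R z - R a) x = (R z o\<^sub>L (W z - W a) o\<^sub>L R a) x"
      by (simp add: blinfun.diff_left)
  qed
  \<comment> \<open>The bound on \<open>R z\<close> depends on \<open>z\<close>, but it stays finite
    near \<open>a\<close> because \<open>norm (W z)\<close> tends to
    \<open>norm (W a) < 1\<close>.\<close>
  have "((\<lambda>z. inverse (1 - norm (W z)) * norm (W z - W a) * norm (R a)) \<longlongrightarrow>
      inverse (1 - norm (W a)) * norm (W a - W a) * norm (R a)) (at a within S)"
    using W[OF a] by (intro tendsto_intros W_lim) auto
  then have "((\<lambda>z. inverse (1 - norm (W z)) * norm (W z - W a) * norm (R a)) \<longlongrightarrow> 0) (at a within S)"
    by simp
  moreover have "eventually (\<lambda>z. norm (R z - R a) \<le>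
      inverse (1 - norm (W z)) * norm (W z - W a) * norm (R a)) (at a within S)"
  proof -
    have "norm (R z - R a) \<le> inverse (1 - norm (W z)) * norm (W z - W a) * norm (R a)"
      if z: "z \<in> S" for z
    proof -
      have "norm (R z - R a) \<le> norm (R z o\<^sub>L (W z - W a)) * norm (R a)"
        unfolding diff[OF z] by (rule norm_blinfun_compose)
      also have "\<dots> \<le> (norm (R z) * norm (W z - W a)) * norm (R a)"
        by (intro mult_right_mono norm_blinfun_compose norm_ge_zero)
      also have "\<dots> \<le> (inverse (1 - norm (W z)) * norm (W z - W a)) * norm (R a)"
        using norm_blinfun_inverse_le[OF W[OF z]]
        by (intro mult_right_mono norm_ge_zero) (simp add: R_def)
      finally show ?thesis .
    qed
    then show ?thesis by (auto simp: eventually_at_filter)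
  qed
  ultimately have "((\<lambda>z. R z - R a) \<longlongrightarrow> 0) (at a within S)"
    by (rule Lim_null_comparison[rotated])
  then have R_lim: "(R \<longlongrightarrow> R a) (at a within S)"
    by (simp add: Lim_null[symmetric])
  have "((\<lambda>z. R z o\<^sub>L (inverse (z - a) *\<^sub>C (W z - W a)) o\<^sub>L R a) \<longlongrightarrow> (R a o\<^sub>L W' o\<^sub>L R a)) (at a within S)"
    by (intro bounded_bilinear.tendsto[OF bounded_bilinear_blinfun_compose] R_lim W' tendsto_const)
  moreover have "eventually (\<lambda>z. R z o\<^sub>L (inverse (z - a) *\<^sub>C (W z - W a)) o\<^sub>L R a
      = inverse (z - a) *\<^sub>C (R z - R a)) (at a within S)"
    unfolding eventually_at_filter
  proof (intro always_eventually allI impI)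
    fix z assume "z \<in> S"
    then show "R z o\<^sub>L (inverse (z - a) *\<^sub>C (W z - W a)) o\<^sub>L R a = inverse (z - a) *\<^sub>C (R z - R a)"
      using complex_linear_blinfun_inverse[OF W lin, of z, folded R_def]
      by (simp only: diff blinfun_compose_scaleC_left blinfun_compose_scaleC_right)
  qed
  ultimately have "((\<lambda>z. inverse (z - a) *\<^sub>C (R z - R a)) \<longlongrightarrow> (R a o\<^sub>L W' o\<^sub>L R a)) (at a within S)"
    by (rule Lim_transform_eventually)
  then show "\<exists>l. ((\<lambda>z. inverse (z - a) *\<^sub>C (blinfun_inverse (id_blinfun - W z)
      - blinfun_inverse (id_blinfun - W a))) \<longlongrightarrow> l) (at a within S)"
    unfolding R_def by blast
qed

section \<open>Adjoints and extension of contractions\<close>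

text \<open>The first variation vanishes at a minimum; this is what yields the representation in
  \<open>riesz_subspace\<close>.\<close>

lemma zero_if_quadratic_nonneg:
  fixes a b :: real
  assumes b: "b \<ge> 0" and nonneg: "\<And>s. 0 \<le> 2 * s * a + s\<^sup>2 * b"
  shows "a = 0"
proof (rule ccontr)
  assume "a \<noteq> 0"
  \<comment> \<open>The test point is \<open>s = - t\<close>. Dividing by \<open>b + 1\<close>
    rather than \<open>b\<close> also covers \<open>b = 0\<close>.\<close>
  define t where "t = a / (b + 1)"
  have a: "a = t * (b + 1)" using b by (simp add: t_def)
  then have "0 < t\<^sup>2 * (b + 2)" using \<open>a \<noteq> 0\<close> b by simp
  moreover have "2 * (- t) * a + (- t)\<^sup>2 * b = - (t\<^sup>2 * (b + 2))"
    unfolding a by (simp add: power2_eq_square algebra_simps)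
  ultimately show False
    using nonneg[of "- t"] by linarith
qed

text \<open>The representing vector minimises \<open>\<parallel>v\<parallel>\<^sup>2 - 2 t\<close>. The functional is given by its graph, so
  that neither a choice of values nor an extension to the closure is needed.\<close>

lemma riesz_subspace:
  fixes G :: "('a::{real_inner, complete_space} \<times> real) set"
  assumes G: "subspace G" and bound: "\<And>v t. (v, t) \<in> G \<Longrightarrow> \<bar>t\<bar> \<le> C * norm v"
  obtains v where "v \<in> closure (fst ` G)" "\<And>z t. (z, t) \<in> G \<Longrightarrow> inner v z = t"
proof -
  define J where "J p = (norm (fst p))\<^sup>2 - 2 * snd p" for p :: "'a \<times> real"
  define m where "m = Inf (J ` G)"
  \<comment> \<open>Completing the square bounds \<open>J\<close> from below, so the infimum
    \<open>m\<close> is meaningful.\<close>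
  have lower: "- (C\<^sup>2) \<le> J p" if "p \<in> G" for p
  proof -
    have "snd p \<le> C * norm (fst p)"
      using bound[of "fst p" "snd p"] that by simp
    moreover have "0 \<le> (norm (fst p) - C)\<^sup>2" by simp
    ultimately show ?thesis by (simp add: J_def power2_eq_square algebra_simps)
  qed
  then have bdd: "bdd_below (J ` G)"
    by (intro bdd_belowI2)
  have m_le: "m \<le> J p" if "p \<in> G" for p
    unfolding m_def using that by (intro cINF_lower bdd)
  have "\<exists>p\<in>G. J p < m + 1 / real (Suc n)" for n
    using cINF_less_iff[of G J "m + 1 / real (Suc n)"] subspace_0[OF G] bdd
    by (fastforce simp: m_def)
  then obtain p where p: "\<And>n. p n \<in> G" and J_p: "\<And>n. J (p n) < m + 1 / real (Suc n)"
    by metis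
  \<comment> \<open>Parallelogram law: the midpoint of two points of \<open>G\<close> lies in
    \<open>G\<close>, so \<open>J\<close> is at least \<open>m\<close> there, and the linear part of
    \<open>J\<close> cancels. Nearly minimal points therefore have close first components.\<close>
  have dist_sq: "(dist (fst (p i)) (fst (p j)))\<^sup>2 \<le> 2 / real (Suc i) + 2 / real (Suc j)" for i j
  proof -
    have "(1 / 2) *\<^sub>R (p i + p j) \<in> G"
      using p by (intro subspace_scale subspace_add G)
    then have "m \<le> J ((1 / 2) *\<^sub>R (p i + p j))" by (rule m_le)
    moreover have "(norm (fst (p i) - fst (p j)))\<^sup>2
        = 2 * J (p i) + 2 * J (p j) - 4 * J ((1 / 2) *\<^sub>R (p i + p j))"
      by (simp add: J_def power2_norm_eq_inner algebra_simps inner_commute)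
    ultimately show ?thesis
      using J_p[of i] J_p[of j] by (simp add: dist_norm)
  qed
  have "Cauchy (\<lambda>n. fst (p n))"
  proof (rule metric_CauchyI)
    fix e :: real assume e: "e > 0"
    obtain M where M: "4 / e\<^sup>2 < real M"
      using reals_Archimedean2 by blast
    show "\<exists>M. \<forall>i\<ge>M. \<forall>j\<ge>M. dist (fst (p i)) (fst (p j)) < e"
    proof (intro exI allI impI)
      fix i j assume "i \<ge> M" "j \<ge> M"
      then have "4 / e\<^sup>2 < real (Suc i)" "4 / e\<^sup>2 < real (Suc j)"
        using M by linarith+
      then have "2 / real (Suc i) < e\<^sup>2 / 2" "2 / real (Suc j) < e\<^sup>2 / 2"
        using e by (simp_all add: field_simps)
      then have "(dist (fst (p i)) (fst (p j)))\<^sup>2 < e\<^sup>2"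
        using dist_sq[of i j] by linarith
      then show "dist (fst (p i)) (fst (p j)) < e"
        using e by (simp add: power_less_imp_less_base)
    qed
  qed
  then obtain v where v: "(\<lambda>n. fst (p n)) \<longlonglongrightarrow> v"
    using Cauchy_convergent convergent_def by blast
  show thesis
  proof (rule that)
    show "v \<in> closure (fst ` G)"
      unfolding closure_sequential using v p by (intro exI[of _ "\<lambda>n. fst (p n)"]) auto
    fix z t assume zt: "(z, t) \<in> G"
    \<comment> \<open>The limit \<open>v\<close> may lie outside the domain of the functional, so
      the variation in direction \<open>(z, t)\<close> is made at \<open>p n\<close>, where
      minimality fails by less than \<open>1 / Suc n\<close>, and then passed to the limit.\<close>
    have "inner v z - t = 0"
    proof (rule zero_if_quadratic_nonneg)
      show "0 \<le> (norm z)\<^sup>2" by simp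
      fix s
      have "0 \<le> 1 / real (Suc n) + (2 * s * (inner (fst (p n)) z - t) + s\<^sup>2 * (norm z)\<^sup>2)" for n
      proof -
        have "p n + s *\<^sub>R (z, t) \<in> G"
          using p zt by (intro subspace_scale subspace_add G)
        then have "m \<le> J (p n + s *\<^sub>R (z, t))" by (rule m_le)
        also have "\<dots> = J (p n) + (2 * s * (inner (fst (p n)) z - t) + s\<^sup>2 * (norm z)\<^sup>2)"
          by (simp add: J_def power2_norm_eq_inner inner_commute algebra_simps)
             (simp add: power2_eq_square)
        finally show ?thesis using J_p[of n] by linarith
      qed
      moreover have "(\<lambda>n. 1 / real (Suc n) + (2 * s * (inner (fst (p n)) z - t) + s\<^sup>2 * (norm z)\<^sup>2))
          \<longlonglongrightarrow> 0 + (2 * s * (inner v z - t) + s\<^sup>2 * (norm z)\<^sup>2)"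
        by (intro tendsto_intros v LIMSEQ_Suc[OF lim_1_over_n])
      ultimately show "0 \<le> 2 * s * (inner v z - t) + s\<^sup>2 * (norm z)\<^sup>2"
        by (intro LIMSEQ_le_const[of _ "2 * s * (inner v z - t) + s\<^sup>2 * (norm z)\<^sup>2"]) (simp_all only: add_0, blast)
    qed
    then show "inner v z = t" by simp
  qed
qed

lemma closure_inner_le:
  assumes "v \<in> closure M" "\<And>z. z \<in> M \<Longrightarrow> inner w z \<le> C * norm z"
  shows "inner w v \<le> C * norm (v::'a::real_inner)"
proof -
  obtain x where x: "\<And>n. x n \<in> M" "x \<longlonglongrightarrow> v"
    using assms(1) unfolding closure_sequential by blast
  show ?thesis
  proof (rule LIMSEQ_le)
    show "(\<lambda>n. inner w (x n)) \<longlonglongrightarrow> inner w v" "(\<lambda>n. C * norm (x n)) \<longlonglongrightarrow> C * norm v"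
      by (intro tendsto_intros x)+
    show "\<exists>N. \<forall>n\<ge>N. inner w (x n) \<le> C * norm (x n)"
      using assms(2) x(1) by blast
  qed
qed

section \<open>Complex subspaces and operators given by their graphs\<close>

definition complex_subspace :: "'a::complex_normed_vector set \<Rightarrow> bool"
  where "complex_subspace M \<longleftrightarrow>
    0 \<in> M \<and> (\<forall>x\<in>M. \<forall>y\<in>M. x + y \<in> M) \<and> (\<forall>c. \<forall>x\<in>M. c *\<^sub>C x \<in> M)"

lemma complex_subspace_0: "complex_subspace M \<Longrightarrow> 0 \<in> M"
  and complex_subspace_add: "complex_subspace M \<Longrightarrow> x \<in> M \<Longrightarrow> y \<in> M \<Longrightarrow> x + y \<in> M"
  and complex_subspace_scaleC: "complex_subspace M \<Longrightarrow> x \<in> M \<Longrightarrow> c *\<^sub>C x \<in> M"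
  by (auto simp: complex_subspace_def)

lemma complex_subspace_diff:
  "complex_subspace M \<Longrightarrow> x \<in> M \<Longrightarrow> y \<in> M \<Longrightarrow> x - y \<in> M"
  using complex_subspace_add[of M x "- y"] complex_subspace_scaleC[of M y "- 1"]
    scaleR_scaleC[of "- 1" y] by simp

lemma complex_subspace_closure:
  assumes M: "complex_subspace M" shows "complex_subspace (closure M)"
  unfolding complex_subspace_def
proof (intro conjI ballI allI)
  show "0 \<in> closure M"
    using M closure_subset by (auto simp: complex_subspace_def)
next
  fix x y assume "x \<in> closure M" "y \<in> closure M"
  then obtain a b where "\<And>n. a n \<in> M" "a \<longlonglongrightarrow> x" "\<And>n. b n \<in> M" "b \<longlonglongrightarrow> y"
    unfolding closure_sequential by blast
  then show "x + y \<in> closure M"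
    unfolding closure_sequential
    by (intro exI[of _ "\<lambda>n. a n + b n"]) (auto intro: tendsto_add complex_subspace_add[OF M])
next
  fix c x assume "x \<in> closure M"
  then obtain a where "\<And>n. a n \<in> M" "a \<longlonglongrightarrow> x"
    unfolding closure_sequential by blast
  then show "c *\<^sub>C x \<in> closure M"
    unfolding closure_sequential
    by (intro exI[of _ "\<lambda>n. c *\<^sub>C a n"])
       (auto intro: tendsto_scaleC tendsto_const complex_subspace_scaleC[OF M])
qed

lemma complex_subspace_fst:
  assumes G: "complex_subspace G" shows "complex_subspace (fst ` G)"
  unfolding complex_subspace_def
proof (intro conjI ballI allI)
  show "0 \<in> fst ` G"
    using complex_subspace_0[OF G] by (rule rev_image_eqI) simp
next
  fix x y assume "x \<in> fst ` G" "y \<in> fst ` G"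
  then obtain p q where "p \<in> G" "q \<in> G" "x = fst p" "y = fst q" by blast
  then show "x + y \<in> fst ` G"
    by (intro rev_image_eqI[OF complex_subspace_add[OF G]]) simp_all
next
  fix c x assume "x \<in> fst ` G"
  then obtain p where "p \<in> G" "x = fst p" by blast
  then show "c *\<^sub>C x \<in> fst ` G"
    by (intro rev_image_eqI[OF complex_subspace_scaleC[OF G]]) simp_all
qed

text \<open>\<open>G\<close> is the graph of a bounded map that may be defined on a subspace only;
  the bound makes it single-valued. For each \<open>x\<close> the functional
  \<open>b \<mapsto> inner x f\<close> is represented by a vector in the closure of the domain, and
  this location makes the vector unique, hence linear in \<open>x\<close>.\<close>

lemma adjoint_of_relation:
  fixes G :: "('a::complex_hilbert_space \<times> 'b::complex_hilbert_space) set"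
  assumes G: "complex_subspace G" and C: "0 \<le> C"
    and bound: "\<And>b f. (b, f) \<in> G \<Longrightarrow> norm f \<le> C * norm b"
  obtains B :: "'b \<Rightarrow>\<^sub>L 'a" where "complex_linear B" "norm B \<le> C"
    "\<And>b f x. (b, f) \<in> G \<Longrightarrow> inner (B x) b = inner x f"
proof -
  let ?M = "closure (fst ` G)"
  have M: "complex_subspace ?M"
    by (intro complex_subspace_closure complex_subspace_fst G)
  have "\<exists>v. v \<in> ?M \<and> (\<forall>b f. (b, f) \<in> G \<longrightarrow> inner v b = inner x f)" for x
  proof -
    let ?G = "(\<lambda>(b, f). (b, inner x f)) ` G"
    have scaleR: "r *\<^sub>R p \<in> G" if "p \<in> G" for r p
      using complex_subspace_scaleC[OF G that] by (simp add: scaleR_scaleC)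
    have sub: "subspace ?G"
      unfolding subspace_def
    proof (intro conjI ballI allI)
      show "0 \<in> ?G"
        using complex_subspace_0[OF G] by (force simp: zero_prod_def)
    next
      fix p q assume "p \<in> ?G" "q \<in> ?G"
      then obtain b f b' f' where "(b, f) \<in> G" "(b', f') \<in> G" "p = (b, inner x f)" "q = (b', inner x f')"
        by auto
      then show "p + q \<in> ?G"
        using complex_subspace_add[OF G, of "(b, f)" "(b', f')"]
        by (auto simp: inner_add_right intro!: image_eqI[of _ _ "(b + b', f + f')"])
    next
      fix r p assume "p \<in> ?G"
      then obtain b f where "(b, f) \<in> G" "p = (b, inner x f)"
        by auto
      then show "r *\<^sub>R p \<in> ?G"
        using scaleR[of "(b, f)" r] by (auto intro!: image_eqI[of _ _ "(r *\<^sub>R b, r *\<^sub>R f)"])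
    qed
    have bd: "\<bar>t\<bar> \<le> (norm x * C) * norm v" if "(v, t) \<in> ?G" for v t
    proof -
      obtain f where f: "(v, f) \<in> G" "t = inner x f" using \<open>(v, t) \<in> ?G\<close> by auto
      have "\<bar>t\<bar> \<le> norm x * norm f"
        unfolding f(2) by (rule Cauchy_Schwarz_ineq2)
      also have "\<dots> \<le> norm x * (C * norm v)"
        by (intro mult_left_mono bound f) simp
      finally show ?thesis by (simp add: mult.assoc)
    qed
    obtain v where "v \<in> closure (fst ` ?G)" "\<And>z t. (z, t) \<in> ?G \<Longrightarrow> inner v z = t"
      using riesz_subspace[OF sub bd] by blast
    moreover have "fst ` ?G = fst ` G"
      by (auto simp: image_image case_prod_beta)
    ultimately show ?thesis by force
  qed
  then obtain g where g: "\<And>x. g x \<in> ?M" and g_inner: "\<And>x b f. (b, f) \<in> G \<Longrightarrow> inner (g x) b = inner x f"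
    by metis
  have g_eq: "g x = v" if v: "v \<in> ?M" "\<And>b f. (b, f) \<in> G \<Longrightarrow> inner v b = inner x f" for x v
  proof -
    \<comment> \<open>The difference lies in the closure of the domain and is orthogonal to the
      domain, hence to itself.\<close>
    have "inner (g x - v) (g x - v) \<le> 0 * norm (g x - v)"
    proof (rule closure_inner_le)
      show "g x - v \<in> closure (fst ` G)"
        using g v by (intro complex_subspace_diff M)
      show "inner (g x - v) z \<le> 0 * norm z" if "z \<in> fst ` G" for z
        using that v g_inner by (force simp: inner_diff_left)
    qed
    then show ?thesis
      using inner_ge_zero[of "g x - v"] by (metis inner_eq_zero_iff mult_zero_left order_antisym right_minus_eq)
  qed
  have g_norm: "norm (g x) \<le> norm x * C" for x
  proof -
    have "inner (g x) (g x) \<le> (norm x * C) * norm (g x)"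
    proof (rule closure_inner_le[OF g])
      fix z assume "z \<in> fst ` G"
      then obtain f where f: "(z, f) \<in> G" by auto
      have "inner x f \<le> norm x * norm f" by (rule norm_cauchy_schwarz)
      also have "\<dots> \<le> norm x * (C * norm z)"
        by (intro mult_left_mono bound f) simp
      finally show "inner (g x) z \<le> norm x * C * norm z"
        by (simp add: g_inner[OF f] mult.assoc)
    qed
    then show ?thesis
      using C by (cases "g x = 0") (simp_all add: power2_norm_eq_inner[symmetric] power2_eq_square)
  qed
  have g_scaleC: "g (c *\<^sub>C x) = c *\<^sub>C g x" for c x
  proof (rule g_eq)
    show "c *\<^sub>C g x \<in> ?M"
      by (intro complex_subspace_scaleC M g)
    fix b f assume "(b, f) \<in> G"
    \<comment> \<open>Moving \<open>c\<close> across the real inner product turns it into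
      \<open>cnj c\<close>; invariance of \<open>G\<close> under complex scalars thus makes
      \<open>g\<close> complex linear.\<close>
    then have "(cnj c *\<^sub>C b, cnj c *\<^sub>C f) \<in> G"
      using complex_subspace_scaleC[OF G] by (force simp: scaleC_prod_def)
    then show "inner (c *\<^sub>C g x) b = inner (c *\<^sub>C x) f"
      by (simp add: inner_scaleC_left g_inner)
  qed
  have "bounded_linear g"
  proof (rule bounded_linear_intro[OF _ _ g_norm])
    show "g (x + y) = g x + g y" for x y
      by (intro g_eq complex_subspace_add M g) (simp add: g_inner inner_add_left)
    show "g (r *\<^sub>R x) = r *\<^sub>R g x" for r x
      by (simp add: scaleR_scaleC g_scaleC)
  qed
  then have ap: "blinfun_apply (Blinfun g) x = g x" for x
    by (simp add: bounded_linear_Blinfun_apply)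
  show thesis
  proof (rule that[of "Blinfun g"])
    show "complex_linear (Blinfun g)"
      by (simp add: complex_linear_def ap g_scaleC)
    show "norm (Blinfun g) \<le> C"
      using g_norm C by (intro norm_blinfun_bound) (simp_all add: ap mult.commute)
  qed (simp add: ap g_inner)
qed

lemma adjoint_exists:
  fixes A :: "'a::complex_hilbert_space \<Rightarrow>\<^sub>L 'b::complex_hilbert_space"
  assumes A: "complex_linear A"
  obtains B where "complex_linear B" "norm B \<le> norm A" "\<And>x y. inner (B y) x = inner y (A x)"
proof -
  let ?G = "range (\<lambda>x. (x, A x))"
  have "complex_subspace ?G"
    unfolding complex_subspace_def
    by (auto simp: image_iff zero_prod_def scaleC_prod_def blinfun.add_right complex_linearD[OF A])
  then obtain B where "complex_linear B" "norm B \<le> norm A"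
    "\<And>b f x. (b, f) \<in> ?G \<Longrightarrow> inner (B x) b = inner x f"
    using norm_blinfun[of A] by (elim adjoint_of_relation[of ?G "norm A"]) auto
  then show thesis by (intro that[of B]) auto
qed

text \<open>Two adjoints in succession: \<open>B\<close> is the adjoint of the relation and
  \<open>A\<close> that of \<open>B\<close>. Then \<open>A b - f\<close> is orthogonal to every
  vector, and no separate extension to the closure of the domain and to its complement is
  made.\<close>

lemma contraction_extending_relation:
  fixes G :: "('a::complex_hilbert_space \<times> 'b::complex_hilbert_space) set"
  assumes G: "complex_subspace G" and bound: "\<And>b f. (b, f) \<in> G \<Longrightarrow> norm f \<le> norm b"
  obtains A :: "'a \<Rightarrow>\<^sub>L 'b" where "complex_linear A" "norm A \<le> 1" "\<And>b f. (b, f) \<in> G \<Longrightarrow> A b = f"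
proof -
  obtain B :: "'b \<Rightarrow>\<^sub>L 'a" where B: "complex_linear B" "norm B \<le> 1"
    and B_inner: "\<And>b f x. (b, f) \<in> G \<Longrightarrow> inner (B x) b = inner x f"
    using adjoint_of_relation[OF G, of 1] bound by auto
  obtain A where A: "complex_linear A" "norm A \<le> norm B" and A_inner: "\<And>x y. inner (A y) x = inner y (B x)"
    using adjoint_exists[OF B(1)] by blast
  show thesis
  proof (rule that)
    show "complex_linear A" "norm A \<le> 1" using A B by auto
    fix b f assume "(b, f) \<in> G"
    then have "inner (A b - f) x = 0" for x
      using B_inner[of b f x] by (simp add: inner_diff_left A_inner inner_commute[of b] inner_commute[of x])
    then show "A b = f"
      using inner_eq_zero_iff[of "A b - f"] by simp
  qed
qed

section \<open>The Hilbert space of square summable sequences\<close>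

lemma norm_add_sq_le: "(norm (x + y))\<^sup>2 \<le> 2 * (norm x)\<^sup>2 + 2 * (norm (y::'a::real_inner))\<^sup>2"
proof -
  have "0 \<le> (norm (x - y))\<^sup>2" by simp
  then show ?thesis by (simp add: power2_norm_eq_inner algebra_simps inner_commute)
qed

lemma l2_seq_add: "x \<in> l2_seq \<Longrightarrow> y \<in> l2_seq \<Longrightarrow> (\<lambda>n. x n + y n) \<in> l2_seq"
proof -
  assume "x \<in> l2_seq" "y \<in> l2_seq"
  then have "summable (\<lambda>n. 2 * (norm (x n))\<^sup>2 + 2 * (norm (y n))\<^sup>2)"
    unfolding l2_seq_def by (intro summable_add summable_mult) simp_all
  then show ?thesis
    unfolding l2_seq_def mem_Collect_eq
    by (rule summable_comparison_test') (simp add: norm_add_sq_le)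
qed

lemma l2_seq_scaleC: "x \<in> l2_seq \<Longrightarrow> (\<lambda>n. c *\<^sub>C x n) \<in> l2_seq"
  unfolding l2_seq_def by (auto simp: norm_scaleC power_mult_distrib intro: summable_mult)

lemma l2_seq_minus: "x \<in> l2_seq \<Longrightarrow> (\<lambda>n. - x n) \<in> l2_seq"
  unfolding l2_seq_def by simp

lemma summable_inner_l2:
  assumes "x \<in> l2_seq" "y \<in> l2_seq" shows "summable (\<lambda>n. inner (x n) (y n))"
proof (rule summable_comparison_test')
  show "summable (\<lambda>n. (norm (x n))\<^sup>2 + (norm (y n))\<^sup>2)"
    using assms unfolding l2_seq_def by (intro summable_add) simp_all
  fix n
  have "\<bar>inner (x n) (y n)\<bar> \<le> norm (x n) * norm (y n)"
    by (rule Cauchy_Schwarz_ineq2)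
  also have "\<dots> \<le> (norm (x n))\<^sup>2 + (norm (y n))\<^sup>2"
    using sum_squares_bound[of "norm (x n)" "norm (y n)"]
      mult_nonneg_nonneg[OF norm_ge_zero norm_ge_zero, of "x n" "y n"] by linarith
  finally show "norm (inner (x n) (y n)) \<le> (norm (x n))\<^sup>2 + (norm (y n))\<^sup>2"
    by simp
qed

text \<open>The sequences become a type of their own, so that bounded operators, adjoints and direct
  sums are available for them.\<close>

typedef (overloaded) 'a l2 = "l2_seq :: (nat \<Rightarrow> 'a::complex_hilbert_space) set"
  morphisms l2_nth Abs_l2
  by (rule exI[of _ "\<lambda>_. 0"]) (simp add: l2_seq_def)

lemma l2_nth_mem: "l2_nth x \<in> l2_seq"
  by (rule l2_nth)

lemma l2_nth_Abs: "f \<in> l2_seq \<Longrightarrow> l2_nth (Abs_l2 f) = f"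
  by (rule Abs_l2_inverse)

lemma l2_eqI: "(\<And>n. l2_nth x n = l2_nth y n) \<Longrightarrow> x = y"
  by (simp add: l2_nth_inject[symmetric] fun_eq_iff)

instantiation l2 :: (complex_hilbert_space) complex_normed_vector
begin

definition "zero_l2 = Abs_l2 (\<lambda>_. 0)"
definition "plus_l2 x y = Abs_l2 (\<lambda>n. l2_nth x n + l2_nth y n)"
definition "uminus_l2 x = Abs_l2 (\<lambda>n. - l2_nth x n)"
definition "minus_l2 x y = (x :: 'a l2) + - y"
definition "scaleC_l2 c x = Abs_l2 (\<lambda>n. c *\<^sub>C l2_nth x n)"
definition "scaleR_l2 r x = complex_of_real r *\<^sub>C (x :: 'a l2)"
definition "norm_l2 x = l2_norm (l2_nth x)"
definition "dist_l2 x y = norm (x - y :: 'a l2)"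
definition "sgn_l2 x = inverse (norm x) *\<^sub>R (x :: 'a l2)"
definition "uniformity_l2 = (INF e\<in>{0 <..}. principal {(x, y). dist x (y :: 'a l2) < e})"
definition "open_l2 U \<longleftrightarrow> (\<forall>x\<in>U. eventually (\<lambda>(x', y). x' = x \<longrightarrow> (y :: 'a l2) \<in> U) uniformity)"

lemma l2_nth_zero [simp]: "l2_nth 0 n = 0"
  by (simp add: zero_l2_def l2_nth_Abs l2_seq_def)

lemma l2_nth_plus [simp]: "l2_nth (x + y) n = l2_nth x n + l2_nth y n"
  by (simp add: plus_l2_def l2_nth_Abs l2_seq_add l2_nth_mem)

lemma l2_nth_uminus [simp]: "l2_nth (- x) n = - l2_nth x n"
  by (simp add: uminus_l2_def l2_nth_Abs l2_seq_minus l2_nth_mem)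

lemma l2_nth_minus [simp]: "l2_nth (x - y) n = l2_nth x n - l2_nth y n"
  by (simp add: minus_l2_def)

lemma l2_nth_scaleC [simp]: "l2_nth (c *\<^sub>C x) n = c *\<^sub>C l2_nth x n"
  by (simp add: scaleC_l2_def l2_nth_Abs l2_seq_scaleC l2_nth_mem)

lemma l2_nth_scaleR [simp]: "l2_nth (r *\<^sub>R x) n = r *\<^sub>R l2_nth x n"
  by (simp add: scaleR_l2_def scaleR_scaleC)

lemma sums_norm_l2: "(\<lambda>n. (norm (l2_nth x n))\<^sup>2) sums (norm x)\<^sup>2"
  using l2_nth_mem[of x] unfolding l2_seq_def norm_l2_def l2_norm_def
  by (simp add: suminf_nonneg summable_sums)

lemma sum_norm_l2_le: "finite I \<Longrightarrow> (\<Sum>n\<in>I. (norm (l2_nth x n))\<^sup>2) \<le> (norm x)\<^sup>2"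
  using sum_le_suminf[of "\<lambda>n. (norm (l2_nth x n))\<^sup>2" I] sums_norm_l2[of x] by (simp add: sums_iff)

lemma norm_ge_zero_l2: "0 \<le> norm (x :: 'a l2)"
  using l2_nth_mem[of x] by (simp add: norm_l2_def l2_norm_def suminf_nonneg l2_seq_def)

lemma norm_l2_eq_0: "norm x = 0 \<longleftrightarrow> x = (0 :: 'a l2)"
proof
  assume "norm x = 0"
  then have "(\<lambda>n. (norm (l2_nth x n))\<^sup>2) sums 0"
    using sums_norm_l2[of x] by simp
  then have "\<forall>n. (norm (l2_nth x n))\<^sup>2 = 0"
    using suminf_eq_zero_iff[of "\<lambda>n. (norm (l2_nth x n))\<^sup>2"] by (auto simp: sums_iff)
  then show "x = 0" by (intro l2_eqI) simp
next
  assume "x = 0"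
  then show "norm x = 0"
    by (simp add: norm_l2_def l2_norm_def)
qed

lemma norm_scaleC_l2: "norm (c *\<^sub>C x) = cmod c * norm (x :: 'a l2)"
proof -
  have "(\<lambda>n. (norm (l2_nth (c *\<^sub>C x) n))\<^sup>2) sums ((cmod c)\<^sup>2 * (norm x)\<^sup>2)"
    using sums_mult[OF sums_norm_l2[of x], of "(cmod c)\<^sup>2"]
    by (simp add: norm_scaleC power_mult_distrib)
  then have "(norm (c *\<^sub>C x))\<^sup>2 = (cmod c * norm x)\<^sup>2"
    unfolding power_mult_distrib by (rule sums_unique2[OF sums_norm_l2])
  then show ?thesis
    by (simp add: power2_eq_iff_nonneg norm_ge_zero_l2)
qed

text \<open>Minkowski's inequality for finite sums, passed to the limit.\<close>

lemma norm_triangle_l2: "norm (x + y) \<le> norm x + norm (y :: 'a l2)"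
proof -
  have "(\<Sum>n<K. (norm (l2_nth (x + y) n))\<^sup>2) \<le> (norm x + norm y)\<^sup>2" for K
  proof -
    have L2_le: "L2_set (\<lambda>n. norm (l2_nth u n)) {..<K} \<le> norm u" for u :: "'a l2"
      unfolding L2_set_def by (intro real_le_lsqrt norm_ge_zero_l2 sum_norm_l2_le) simp
    have "L2_set (\<lambda>n. norm (l2_nth (x + y) n)) {..<K}
        \<le> L2_set (\<lambda>n. norm (l2_nth x n) + norm (l2_nth y n)) {..<K}"
      by (intro L2_set_mono) (simp_all add: norm_triangle_ineq)
    also have "\<dots> \<le> L2_set (\<lambda>n. norm (l2_nth x n)) {..<K} + L2_set (\<lambda>n. norm (l2_nth y n)) {..<K}"
      by (rule L2_set_triangle_ineq)
    also have "\<dots> \<le> norm x + norm y"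
      by (intro add_mono L2_le)
    finally show ?thesis
      unfolding L2_set_def by (rule sqrt_le_D)
  qed
  then have "(norm (x + y))\<^sup>2 \<le> (norm x + norm y)\<^sup>2"
    by (intro LIMSEQ_le_const2[OF sums_norm_l2[unfolded sums_def]]) blast
  then show ?thesis
    by (rule power2_le_imp_le) (simp add: norm_ge_zero_l2)
qed

instance
proof
  fix x y z :: "'a l2" and r s :: real and c d :: complex
  show "x + y + z = x + (y + z)" "x + y = y + x" "0 + x = x" "- x + x = 0"
    by (rule l2_eqI, simp)+
  show "x - y = x + - y" by (simp add: minus_l2_def)
  show "r *\<^sub>R (x + y) = r *\<^sub>R x + r *\<^sub>R y" "(r + s) *\<^sub>R x = r *\<^sub>R x + s *\<^sub>R x"
    "r *\<^sub>R s *\<^sub>R x = (r * s) *\<^sub>R x" "1 *\<^sub>R x = x"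
    by (rule l2_eqI, simp add: algebra_simps)+
  show "dist x y = norm (x - y)" "sgn x = inverse (norm x) *\<^sub>R x"
    by (simp_all add: dist_l2_def sgn_l2_def)
  show "uniformity = (INF e\<in>{0 <..}. principal {(x, y). dist x (y :: 'a l2) < e})"
    by (rule uniformity_l2_def)
  show "open U \<longleftrightarrow> (\<forall>x\<in>U. \<forall>\<^sub>F (x', y) in uniformity. x' = x \<longrightarrow> y \<in> U)" for U :: "'a l2 set"
    by (rule open_l2_def)
  show "norm x = 0 \<longleftrightarrow> x = 0" by (rule norm_l2_eq_0)
  show "norm (x + y) \<le> norm x + norm y" by (rule norm_triangle_l2)
  show "norm (r *\<^sub>R x) = \<bar>r\<bar> * norm x" by (simp add: scaleR_l2_def norm_scaleC_l2)
  show "c *\<^sub>C (x + y) = c *\<^sub>C x + c *\<^sub>C y"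
    by (rule l2_eqI) (simp add: scaleC_add_right)
  show "(c + d) *\<^sub>C x = c *\<^sub>C x + d *\<^sub>C x"
    by (rule l2_eqI) (simp add: scaleC_add_left)
  show "c *\<^sub>C d *\<^sub>C x = (c * d) *\<^sub>C x"
    by (rule l2_eqI) (simp add: scaleC_scaleC)
  show "r *\<^sub>R x = complex_of_real r *\<^sub>C x" by (rule scaleR_l2_def)
  show "norm (c *\<^sub>C x) = cmod c * norm x" by (rule norm_scaleC_l2)
qed

end

lemma norm_l2_nth_le: "norm (l2_nth x n) \<le> norm x"
proof -
  have "(norm (l2_nth x n))\<^sup>2 \<le> (norm x)\<^sup>2"
    using sum_norm_l2_le[of "{n}" x] by simp
  then show ?thesis by (rule power2_le_imp_le) simp
qed

text \<open>Membership and norm bound come together, as needed for a coordinatewise limit that is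
  not yet known to be square summable.\<close>

lemma norm_sq_Abs_l2:
  assumes "\<And>K. (\<Sum>n<K. (norm (f n))\<^sup>2) \<le> B"
  shows "f \<in> l2_seq" "(norm (Abs_l2 f))\<^sup>2 \<le> B"
proof -
  have "summable (\<lambda>n. (norm (f n))\<^sup>2)"
    using assms by (intro bounded_imp_summable[of _ B]) (simp_all add: lessThan_Suc_atMost[symmetric] del: sum.lessThan_Suc)
  then show f: "f \<in> l2_seq" by (simp add: l2_seq_def)
  show "(norm (Abs_l2 f))\<^sup>2 \<le> B"
    using assms by (intro LIMSEQ_le_const2[OF sums_norm_l2[unfolded sums_def]]) (auto simp: l2_nth_Abs[OF f])
qed

section \<open>Inner product and completeness of the sequence space\<close>

instantiation l2 :: (complex_hilbert_space) complex_hilbert_space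
begin

definition "inner_l2 x y = (\<Sum>n. inner (l2_nth x n) (l2_nth y n))"
definition "cinner_l2 x y = (\<Sum>n. cinner (l2_nth x n) (l2_nth y n))"

lemma sums_inner_l2: "(\<lambda>n. inner (l2_nth x n) (l2_nth y n)) sums inner x y"
  unfolding inner_l2_def by (intro summable_sums summable_inner_l2 l2_nth_mem)

lemma sums_cinner_l2: "(\<lambda>n. cinner (l2_nth x n) (l2_nth y n)) sums cinner x y"
proof -
  have "summable (\<lambda>n. of_real (inner (l2_nth x n) (l2_nth y n))
      + \<i> * of_real (inner (l2_nth x n) (l2_nth (\<i> *\<^sub>C y) n)))"
    by (intro summable_add summable_mult summable_of_real summable_inner_l2 l2_nth_mem)
  moreover have "(\<lambda>n. of_real (inner (l2_nth x n) (l2_nth y n))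
      + \<i> * of_real (inner (l2_nth x n) (l2_nth (\<i> *\<^sub>C y) n))) = (\<lambda>n. cinner (l2_nth x n) (l2_nth y n))"
    by (simp add: cinner_eq_Complex complex_eq_iff fun_eq_iff)
  ultimately show ?thesis
    unfolding cinner_l2_def by (simp add: summable_sums)
qed

instance
proof
  fix x y z :: "'a l2" and r :: real and c :: complex
  show "inner x y = inner y x"
    by (simp add: inner_l2_def inner_commute)
  show "inner (x + y) z = inner x z + inner y z"
    using sums_unique2[OF sums_inner_l2[of "x + y" z]] sums_add[OF sums_inner_l2[of x z] sums_inner_l2[of y z]]
    by (simp add: inner_add_left)
  show "inner (r *\<^sub>R x) y = r * inner x y"
    using sums_unique2[OF sums_inner_l2[of "r *\<^sub>R x" y]] sums_mult[OF sums_inner_l2[of x y], of r]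
    by simp
  have inner_self: "inner x x = (norm x)\<^sup>2" for x :: "'a l2"
    using sums_unique[OF sums_norm_l2[of x]] by (simp add: inner_l2_def power2_norm_eq_inner)
  show "0 \<le> inner x x" "inner x x = 0 \<longleftrightarrow> x = 0" "norm x = sqrt (inner x x)"
    by (simp_all add: inner_self)
  have "(\<lambda>n. cinner (l2_nth x n) (l2_nth y n)) = (\<lambda>n. cnj (cinner (l2_nth y n) (l2_nth x n)))"
    by (rule ext) (rule cinner_commute)
  then show "cinner x y = cnj (cinner y x)"
    using sums_unique2[OF sums_cinner_l2[of x y]] sums_cnj[THEN iffD2, OF sums_cinner_l2[of y x]]
    by simp
  show "cinner (x + y) z = cinner x z + cinner y z"
    using sums_unique2[OF sums_cinner_l2[of "x + y" z]] sums_add[OF sums_cinner_l2[of x z] sums_cinner_l2[of y z]]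
    by (simp add: cinner_add_left)
  show "cinner (c *\<^sub>C x) y = c * cinner x y"
    using sums_unique2[OF sums_cinner_l2[of "c *\<^sub>C x" y]] sums_mult[OF sums_cinner_l2[of x y], of c]
    by (simp add: cinner_scaleC_left)
  show "Re (cinner x y) = inner x y"
    using sums_unique2[OF sums_Re[OF sums_cinner_l2[of x y]]] sums_inner_l2[of x y]
    by (simp add: Re_cinner)
next
  fix X :: "nat \<Rightarrow> 'a l2"
  assume X: "Cauchy X"
  have "Cauchy (\<lambda>m. l2_nth (X m) n)" for n
  proof (rule metric_CauchyI)
    fix e :: real assume "e > 0"
    then obtain M where "\<forall>i\<ge>M. \<forall>j\<ge>M. dist (X i) (X j) < e"
      using X unfolding Cauchy_def by blast
    then show "\<exists>M. \<forall>i\<ge>M. \<forall>j\<ge>M. dist (l2_nth (X i) n) (l2_nth (X j) n) < e"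
      using norm_l2_nth_le[of "X _ - X _" n] by (metis dist_norm l2_nth_minus le_less_trans)
  qed
  then obtain L where L: "\<And>n. (\<lambda>m. l2_nth (X m) n) \<longlonglongrightarrow> L n"
    unfolding Cauchy_convergent_iff convergent_def by metis
  \<comment> \<open>In a finite partial sum the index \<open>j\<close> can tend to infinity
    coordinatewise; the resulting bound \<open>e^2\<close> is uniform in the length
    \<open>K\<close>.\<close>
  have close: "\<exists>M. \<forall>i\<ge>M. (\<lambda>n. l2_nth (X i) n - L n) \<in> l2_seq \<and>
      norm (Abs_l2 (\<lambda>n. l2_nth (X i) n - L n)) \<le> e" if e: "e > 0" for e
  proof -
    obtain M where M: "\<And>i j. i \<ge> M \<Longrightarrow> j \<ge> M \<Longrightarrow> dist (X i) (X j) < e"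
      using X e unfolding Cauchy_def by blast
    have bd: "(\<Sum>n<K. (norm (l2_nth (X i) n - L n))\<^sup>2) \<le> e\<^sup>2" if i: "i \<ge> M" for i K
    proof (rule LIMSEQ_le_const2)
      show "(\<lambda>j. \<Sum>n<K. (norm (l2_nth (X i) n - l2_nth (X j) n))\<^sup>2)
          \<longlonglongrightarrow> (\<Sum>n<K. (norm (l2_nth (X i) n - L n))\<^sup>2)"
        by (intro tendsto_intros L)
      have "(\<Sum>n<K. (norm (l2_nth (X i) n - l2_nth (X j) n))\<^sup>2) \<le> e\<^sup>2" if "j \<ge> M" for j
      proof -
        have "(\<Sum>n<K. (norm (l2_nth (X i) n - l2_nth (X j) n))\<^sup>2) \<le> (norm (X i - X j))\<^sup>2"
          using sum_norm_l2_le[of "{..<K}" "X i - X j"] by simp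
        also have "\<dots> \<le> e\<^sup>2"
          using M[OF i that] by (intro power_mono) (simp_all add: dist_norm)
        finally show ?thesis .
      qed
      then show "\<exists>M. \<forall>j\<ge>M. (\<Sum>n<K. (norm (l2_nth (X i) n - l2_nth (X j) n))\<^sup>2) \<le> e\<^sup>2"
        by blast
    qed
    show ?thesis
    proof (intro exI allI impI conjI)
      fix i assume "i \<ge> M"
      note b = norm_sq_Abs_l2[OF bd[OF this]]
      show "(\<lambda>n. l2_nth (X i) n - L n) \<in> l2_seq" by (rule b)
      show "norm (Abs_l2 (\<lambda>n. l2_nth (X i) n - L n)) \<le> e"
        using b(2) less_imp_le[OF e] by (rule power2_le_imp_le)
    qed
  qed
  obtain i where i: "(\<lambda>n. l2_nth (X i) n - L n) \<in> l2_seq"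
    using close[of 1] by auto
  \<comment> \<open>\<open>L\<close> is the difference of \<open>X i\<close> and
    \<open>X i - L\<close>, both square summable.\<close>
  have "(\<lambda>n. l2_nth (X i) n + - (l2_nth (X i) n - L n)) \<in> l2_seq"
    by (intro l2_seq_add l2_seq_minus i l2_nth_mem)
  then have "L \<in> l2_seq" by simp
  then have eq: "Abs_l2 (\<lambda>n. l2_nth (X i) n - L n) = X i - Abs_l2 L"
    if "(\<lambda>n. l2_nth (X i) n - L n) \<in> l2_seq" for i
    using that by (intro l2_eqI) (simp add: l2_nth_Abs)
  have "X \<longlonglongrightarrow> Abs_l2 L"
  proof (rule metric_LIMSEQ_I)
    fix e :: real assume "e > 0"
    then obtain M where M: "\<forall>i\<ge>M. (\<lambda>n. l2_nth (X i) n - L n) \<in> l2_seq \<and>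
        norm (Abs_l2 (\<lambda>n. l2_nth (X i) n - L n)) \<le> e / 2"
      using close[of "e / 2"] by auto
    have "dist (X i) (Abs_l2 L) < e" if "i \<ge> M" for i
      using M that eq[of i] \<open>e > 0\<close> by (fastforce simp: dist_norm)
    then show "\<exists>M. \<forall>i\<ge>M. dist (X i) (Abs_l2 L) < e" by blast
  qed
  then show "convergent X" by (rule convergentI)
qed

end

section \<open>Defect operators\<close>

text \<open>For \<open>0 \<le> x \<le> 1\<close> the recursion \<open>y 0 = x\<close>, \<open>y (n + 1) = y n - (y n)\<^sup>2\<close> telescopes to
  \<open>x = (\<Sum>n. (y n)\<^sup>2)\<close>. The column of all \<open>y n\<close> therefore serves as a square root of \<open>x\<close>.\<close>

primrec telescope :: "('a::real_normed_vector \<Rightarrow>\<^sub>L 'a) \<Rightarrow> nat \<Rightarrow> 'a \<Rightarrow>\<^sub>L 'a" where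
  "telescope x 0 = x"
| "telescope x (Suc n) = telescope x n - (telescope x n o\<^sub>L telescope x n)"

lemma
  fixes x :: "'a::complex_hilbert_space \<Rightarrow>\<^sub>L 'a"
  assumes sym: "\<And>u v. inner (x u) v = inner u (x v)"
    and nonneg: "\<And>u. 0 \<le> inner (x u) u" and le: "\<And>u. inner (x u) u \<le> inner u u"
  shows telescope_symmetric: "inner (telescope x n u) v = inner u (telescope x n v)"
    and telescope_nonneg: "0 \<le> inner (telescope x n u) u"
proof -
  have "(\<forall>u v. inner (telescope x n u) v = inner u (telescope x n v)) \<and>
    (\<forall>u. 0 \<le> inner (telescope x n u) u) \<and> (\<forall>u. inner (telescope x n u) u \<le> inner u u)"
  proof (induction n)
    case 0
    then show ?case using sym nonneg le by simp
  next
    case (Suc n)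
    let ?y = "telescope x n"
    have s: "inner (?y u) v = inner u (?y v)" for u v using Suc by blast
    have p: "0 \<le> inner (?y u) u" for u using Suc by blast
    have l: "inner (?y u) u \<le> inner u u" for u using Suc by blast
    have nn: "0 \<le> inner (?y u - ?y (?y u)) u" for u
    proof -
      let ?v = "u - ?y u"
      \<comment> \<open>This is the identity
        \<open>y - y^2 = (1 - y) y (1 - y) + y (1 - y) y\<close>, whose summands are nonnegative
        when \<open>0 \<le> y \<le> 1\<close>.\<close>
      have "inner (?y u - ?y (?y u)) u = inner (?y ?v) ?v + (inner (?y u) (?y u) - inner (?y (?y u)) (?y u))"
        by (simp add: blinfun.diff_right inner_diff_left inner_diff_right s inner_commute)
      then show ?thesis using p[of ?v] l[of "?y u"] by simp
    qed
    have "inner (?y u - ?y (?y u)) u \<le> inner u u" for u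
    proof -
      have "inner (?y (?y u)) u = inner (?y u) (?y u)" by (simp add: s)
      then show ?thesis
        unfolding inner_diff_left using l[of u] inner_ge_zero[of "?y u"] by linarith
    qed
    then show ?case
      using nn by (simp add: blinfun.diff_left s inner_diff_left inner_diff_right)
  qed
  then show "inner (telescope x n u) v = inner u (telescope x n v)"
    and "0 \<le> inner (telescope x n u) u"
    by auto
qed

lemma complex_linear_telescope: "complex_linear x \<Longrightarrow> complex_linear (telescope x n)"
  by (induction n) (simp_all add: complex_linear_diff complex_linear_compose)

text \<open>The first \<open>n\<close> squares add up to \<open>inner (x u) u\<close> minus a
  remainder. Convergence of the sum forces \<open>telescope x n u\<close> to 0, and with it the
  remainder.\<close>

lemma sums_norm_telescope:
  fixes x :: "'a::complex_hilbert_space \<Rightarrow>\<^sub>L 'a"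
  assumes x: "\<And>u v. inner (x u) v = inner u (x v)" "\<And>u. 0 \<le> inner (x u) u"
    "\<And>u. inner (x u) u \<le> inner u u"
  shows "(\<lambda>n. (norm (telescope x n u))\<^sup>2) sums inner (x u) u"
proof -
  have part: "(\<Sum>k<n. (norm (telescope x k u))\<^sup>2) = inner (x u) u - inner (telescope x n u) u" for n
    by (induction n)
       (simp_all add: blinfun.diff_left inner_diff_left power2_norm_eq_inner telescope_symmetric[OF x])
  have "summable (\<lambda>n. (norm (telescope x n u))\<^sup>2)"
    using telescope_nonneg[OF x]
    by (intro bounded_imp_summable[of _ "inner (x u) u"])
       (simp_all add: part lessThan_Suc_atMost[symmetric] del: sum.lessThan_Suc telescope.simps)
  then have "(\<lambda>n. sqrt ((norm (telescope x n u))\<^sup>2)) \<longlonglongrightarrow> sqrt 0"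
    by (intro tendsto_real_sqrt summable_LIMSEQ_zero)
  then have "(\<lambda>n. telescope x n u) \<longlonglongrightarrow> 0"
    by (simp add: tendsto_norm_zero_iff)
  then have "(\<lambda>n. inner (x u) u - inner (telescope x n u) u) \<longlonglongrightarrow> inner (x u) u - inner 0 u"
    by (intro tendsto_intros)
  then show ?thesis by (simp add: sums_def part)
qed

text \<open>With \<open>S\<close> the adjoint of \<open>T\<close>, the column of all
  \<open>telescope x n\<close> for \<open>x = I - S T\<close> stands in for the positive square root
  of \<open>x\<close>; hence the codomain \<open>'a l2\<close> instead of \<open>'a\<close>.\<close>

lemma defect_operator_exists:
  fixes T :: "'a::complex_hilbert_space \<Rightarrow>\<^sub>L 'b::complex_hilbert_space"
  assumes T: "complex_linear T" "norm T \<le> 1"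
  obtains D :: "'a \<Rightarrow>\<^sub>L 'a l2" where "complex_linear D"
    "\<And>u. (norm (T u))\<^sup>2 + (norm (D u))\<^sup>2 = (norm u)\<^sup>2"
proof -
  obtain S where S: "complex_linear S" "\<And>u v. inner (S v) u = inner v (T u)"
    using adjoint_exists[OF T(1)] by metis
  define x where "x = id_blinfun - (S o\<^sub>L T)"
  have inner_x: "inner (x u) v = inner u v - inner (T u) (T v)" for u v
    by (simp add: x_def blinfun.diff_left inner_diff_left S)
  have sym: "inner (x u) v = inner u (x v)" for u v
    unfolding inner_commute[of u "x v"] inner_x by (simp add: inner_commute)
  have x_self: "inner (x u) u = (norm u)\<^sup>2 - (norm (T u))\<^sup>2" for u
    by (simp add: inner_x power2_norm_eq_inner)
  have nonneg: "0 \<le> inner (x u) u" for u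
    unfolding x_self using power_mono[OF norm_blinfun_le_1D[OF T(2), of u] norm_ge_zero, of 2] by linarith
  have le: "inner (x u) u \<le> inner u u" for u
    by (simp add: x_self power2_norm_eq_inner[of u])
  note sums = sums_norm_telescope[OF sym nonneg le]
  define d where "d u = Abs_l2 (\<lambda>n. telescope x n u)" for u
  have "(\<lambda>n. telescope x n u) \<in> l2_seq" for u
    using sums[of u] by (auto simp: l2_seq_def sums_iff)
  then have nth: "l2_nth (d u) n = telescope x n u" for u n
    by (simp add: d_def l2_nth_Abs)
  have norm_d: "(norm (d u))\<^sup>2 = inner (x u) u" for u
    using sums_unique2[OF sums_norm_l2[of "d u"]] sums[of u] by (simp add: nth)
  have "bounded_linear d"
  proof (rule bounded_linear_intro)
    show "d (u + v) = d u + d v" for u v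
      by (rule l2_eqI) (simp add: nth blinfun.add_right)
    show "d (r *\<^sub>R u) = r *\<^sub>R d u" for r u
      by (rule l2_eqI) (simp add: nth blinfun.scaleR_right)
    show "norm (d u) \<le> norm u * 1" for u
      using le[of u] unfolding norm_d[symmetric] power2_norm_eq_inner[symmetric] mult_1_right
      by (rule power2_le_imp_le) simp
  qed
  then have ap: "blinfun_apply (Blinfun d) u = d u" for u
    by (simp add: bounded_linear_Blinfun_apply)
  have x_lin: "complex_linear x"
    unfolding x_def by (intro complex_linear_diff complex_linear_compose complex_linear_id S T)
  show thesis
  proof (rule that)
    show "complex_linear (Blinfun d)"
      unfolding complex_linear_def ap
      by (intro allI l2_eqI) (simp add: nth complex_linearD[OF complex_linear_telescope[OF x_lin]])
    show "(norm (T u))\<^sup>2 + (norm (Blinfun d u))\<^sup>2 = (norm u)\<^sup>2" for u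
      by (simp add: ap norm_d x_self)
  qed
qed

section \<open>Opening the delay line\<close>

text \<open>\<open>E j\<close> is the cell of the delay line whose content reaches cell 0 after
  \<open>j\<close> steps. In the opened system \<open>V\<close> takes its input in cell 0 and
  reports, next to the output of \<open>C\<close>, what arrives in cell \<open>M\<close>. The second
  conclusion closes the loop again; \<open>z ^ Suc M\<close> is the delay of one passage through the
  line.\<close>

lemma schur_function_of_shift:
  fixes Z :: "'k::complex_hilbert_space \<Rightarrow>\<^sub>L 'k" and C :: "'k \<Rightarrow>\<^sub>L 'y::complex_hilbert_space"
    and E :: "nat \<Rightarrow> 'u::complex_hilbert_space \<Rightarrow>\<^sub>L 'k"
  assumes Z: "complex_linear Z" and C: "complex_linear C" and E: "\<And>j. complex_linear (E j)"
    and contr: "\<And>s. (norm (Z s))\<^sup>2 + (norm (C s))\<^sup>2 \<le> (norm s)\<^sup>2"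
    and ortho: "\<And>i j u v. i \<le> M \<Longrightarrow> j \<le> M \<Longrightarrow> inner (E i u) (E j v) = (if i = j then inner u v else 0)"
    and shift: "\<And>j u. j < M \<Longrightarrow> Z (E (Suc j) u) = E j u"
  obtains V :: "complex \<Rightarrow> 'u \<Rightarrow>\<^sub>L ('y \<times> 'u)" where "V \<in> schur_class"
    "\<And>z w. z \<in> \<bbbD> \<Longrightarrow>
      (\<lambda>n. z ^ n *\<^sub>C C ((blinfun_apply Z ^^ n) (E 0 (w - z ^ Suc M *\<^sub>C snd (V z w))))) sums fst (V z w)"
proof -
  have "\<exists>B. complex_linear B \<and> (\<forall>x y. inner (B y) x = inner y (E j x))" for j
    using adjoint_exists[OF E[of j]] by metis
  then obtain F where F: "\<And>j. complex_linear (F j)"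
    and F_inner: "\<And>j x y. inner (F j y) x = inner y (E j x)"
    by metis
  have FE: "F i (E j u) = (if i = j then u else 0)" if "i \<le> M" "j \<le> M" for i j u
  proof -
    have "inner (F i (E j u) - (if i = j then u else 0)) v = 0" for v
      using ortho[OF that(2,1), of u v] by (simp add: inner_diff_left F_inner)
    then show ?thesis using inner_eq_zero_iff right_minus_eq by blast
  qed
  have Z_norm: "norm (Z s) \<le> norm s" for s
    by (rule power2_le_imp_le[OF order_trans[OF _ contr[of s]]]) simp_all
  \<comment> \<open>The adjoint of a contraction undoes it wherever it is isometric. So
    \<open>B\<close> maps \<open>E j v\<close> to \<open>E (Suc j) v\<close>, and taking adjoints
    gives the claim.\<close>
  have FZ: "F j (Z s) = F (Suc j) s" if j: "j < M" for j s
  proof -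
    obtain B :: "'k \<Rightarrow>\<^sub>L 'k" where B: "\<And>x y. inner (B y) x = inner y (Z x)" "norm B \<le> norm Z"
      using adjoint_exists[OF Z] by metis
    have B_norm: "norm (B y) \<le> norm y" for y
      using Z_norm B(2) norm_blinfun_bound[of 1 Z] by (intro norm_blinfun_le_1D) simp
    have fix_E: "B (E j v) = E (Suc j) v" for v
    proof -
      let ?a = "E (Suc j) v"
      have "inner (B (E j v)) ?a = inner (E j v) (E j v)"
        by (simp add: B shift[OF j])
      also have "\<dots> = inner v v" using ortho[of j j v v] j by simp
      finally have 1: "inner (B (E j v)) ?a = inner v v" .
      have 2: "inner ?a ?a = inner v v" using ortho[of "Suc j" "Suc j" v v] j by simp
      have "(norm (B (E j v)))\<^sup>2 \<le> (norm (E j v))\<^sup>2"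
        by (intro power_mono B_norm) simp
      then have 3: "inner (B (E j v)) (B (E j v)) \<le> inner v v"
        using ortho[of j j v v] j by (simp add: power2_norm_eq_inner)
      \<comment> \<open>Equality in the Cauchy-Schwarz inequality: both vectors have norm at most
        \<open>norm v\<close>, and their inner product is \<open>inner v v\<close>.\<close>
      have "inner (B (E j v) - ?a) (B (E j v) - ?a) \<le> 0"
        using 1 2 3 by (simp add: inner_diff_left inner_diff_right inner_commute)
      then show ?thesis
        by (metis inner_eq_zero_iff inner_ge_zero order_antisym right_minus_eq)
    qed
    have "inner (F j (Z s) - F (Suc j) s) v = 0" for v
    proof -
      have "inner (F j (Z s)) v = inner (E j v) (Z s)"
        by (simp only: F_inner inner_commute[of "E j v"])
      also have "\<dots> = inner (E (Suc j) v) s"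
        by (simp add: B(1)[symmetric] fix_E)
      finally show ?thesis by (simp add: inner_diff_left F_inner inner_commute[of s])
    qed
    then show ?thesis using inner_eq_zero_iff right_minus_eq by blast
  qed
  \<comment> \<open>By \<open>FE\<close>, \<open>P\<close> is the orthogonal projection onto the
    complement of all cells.\<close>
  define P where "P = id_blinfun - (\<Sum>j\<le>M. E j o\<^sub>L F j)"
  have P: "P s = s - (\<Sum>j\<le>M. E j (F j s))" for s
    by (simp add: P_def blinfun.diff_left blinfun.sum_left)
  have FP: "F i (P s) = 0" if i: "i \<le> M" for i s
  proof -
    have "(\<Sum>j\<le>M. F i (E j (F j s))) = (\<Sum>j\<le>M. if j = i then F j s else 0)"
      using i by (intro sum.cong) (simp_all add: FE)
    then show ?thesis using i by (simp add: P blinfun.diff_right blinfun.sum_right)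
  qed
  have norm_P: "(norm s)\<^sup>2 = (norm (P s))\<^sup>2 + (\<Sum>j\<le>M. (norm (F j s))\<^sup>2)" for s
  proof -
    have "inner s (E j (F j s)) = (norm (F j s))\<^sup>2" for j
      by (simp add: F_inner[symmetric] power2_norm_eq_inner)
    then have "inner s s = inner s (P s) + (\<Sum>j\<le>M. (norm (F j s))\<^sup>2)"
      by (simp add: P inner_diff_right inner_sum_right)
    moreover have "inner (P s) (P s) = inner (P s) s"
      by (subst (2) P) (simp add: inner_diff_right inner_sum_right F_inner[symmetric] FP)
    ultimately show ?thesis 
      by (simp only: power2_norm_eq_inner[of s] power2_norm_eq_inner[of "P s"] inner_commute[of s "P s"])
  qed
  \<comment> \<open>Of the cell contents of \<open>Z s\<close> only that of cell \<open>M\<close> is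
    reported; on the states \<open>S z w\<close> below the others are zero.\<close>
  define A where "A = P o\<^sub>L Z"
  define C' where "C' = Blinfun (\<lambda>s. (C s, F M (Z s)))"
  have C': "C' s = (C s, F M (Z s))" for s
    unfolding C'_def
    by (rule fun_cong[OF bounded_linear_Blinfun_apply])
       (intro bounded_linear_Pair blinfun.bounded_linear_right
        bounded_linear_compose[OF blinfun.bounded_linear_right[of "F M"]])
  have A_le: "(norm (A s))\<^sup>2 + (norm (C' s))\<^sup>2 \<le> (norm s)\<^sup>2" for s
  proof -
    have "(norm (F M (Z s)))\<^sup>2 \<le> (\<Sum>j\<le>M. (norm (F j (Z s)))\<^sup>2)"
      by (rule member_le_sum) auto
    then show ?thesis
      using contr[of s] norm_P[of "Z s"] by (simp add: A_def C' norm_prod_def)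
  qed
  have A_norm: "norm A \<le> 1"
  proof (rule norm_blinfun_bound)
    show "norm (A s) \<le> 1 * norm s" for s
      unfolding mult_1 by (rule power2_le_imp_le[OF order_trans[OF _ A_le[of s]]]) simp_all
  qed simp
  have A_lin: "complex_linear A"
    by (simp add: complex_linear_def A_def P complex_linearD[OF Z] complex_linearD[OF E]
        complex_linearD[OF F] scaleC_diff_right scaleC_sum_right)
  have C'_lin: "complex_linear C'"
    by (simp add: complex_linear_def C' complex_linearD[OF Z] complex_linearD[OF C]
        complex_linearD[OF F] scaleC_prod_def)
  have W: "norm (z *\<^sub>C A) < 1" "complex_linear (z *\<^sub>C A)" if "z \<in> \<bbbD>" for z
  proof -
    show "norm (z *\<^sub>C A) < 1"
      using that A_norm mult_left_mono[OF A_norm, of "cmod z"] by (simp add: norm_scaleC)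
    show "complex_linear (z *\<^sub>C A)"
      by (intro complex_linear_scaleC A_lin)
  qed
  define R where "R z = blinfun_inverse (id_blinfun - z *\<^sub>C A)" for z
  have "(\<lambda>z. z *\<^sub>C A) cholomorphic_on \<bbbD>"
    by (intro cholomorphic_on_scaleC cholomorphic_on_const holomorphic_on_ident)
  then have R_hol: "R cholomorphic_on \<bbbD>"
    unfolding R_def using W by (rule cholomorphic_on_blinfun_inverse)
  have R_lin: "complex_linear (R z)" if "z \<in> \<bbbD>" for z
    unfolding R_def using W[OF that] by (rule complex_linear_blinfun_inverse)
  \<comment> \<open>The transfer function \<open>C' (I - z A)^-1 E 0\<close>. There is no direct
    term, because the input is itself part of the state \<open>S z w\<close>.\<close>
  define V where "V z = C' o\<^sub>L (R z o\<^sub>L E 0)" for z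
  define S where "S z w = R z (E 0 w)" for z w
  have V: "V z w = (C (S z w), F M (Z (S z w)))" for z w
    by (simp add: V_def S_def C')
  have S: "S z w = E 0 w + z *\<^sub>C A (S z w)" if "z \<in> \<bbbD>" for z w
    using blinfun_inverse_fixpoint[OF W(1)[OF that], of "E 0 w"]
    by (simp add: S_def R_def scaleC_blinfun.rep_eq algebra_simps)
  \<comment> \<open>The range of \<open>A\<close> is orthogonal to the cells, so cell 0 holds
    exactly the input and the other cells are empty.\<close>
  have FS: "F j (S z w) = (if j = 0 then w else 0)" if "z \<in> \<bbbD>" "j \<le> M" for z w j
    using that by (subst S) (auto simp: blinfun.add_right FE complex_linearD[OF F] A_def FP)
  show thesis
  proof (rule that)
    show "V \<in> schur_class"
      unfolding schur_class_def
    proof (intro CollectI conjI ballI)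
      show "V cholomorphic_on \<bbbD>"
        unfolding V_def
        by (intro cholomorphic_on_blinfun_compose cholomorphic_on_const R_hol C'_lin R_lin)
    next
      fix z :: complex assume z: "z \<in> \<bbbD>"
      show "complex_linear (V z)"
        unfolding V_def by (intro complex_linear_compose C'_lin R_lin[OF z] E)
      show "norm (V z) \<le> 1"
      proof (rule norm_blinfun_bound)
        fix w
        let ?s = "S z w"
        \<comment> \<open>Input and internal part of the state are orthogonal, so the squared norm
          of the state is that of \<open>w\<close> plus that of \<open>z *\<^sub>C A ?s\<close>.
          With \<open>A_le\<close> and \<open>cmod z < 1\<close> the contribution of
          \<open>A ?s\<close> cancels.\<close>
        have "inner (E 0 w) (A ?s) = 0"
          using FP[of 0 "Z ?s"] by (simp add: A_def F_inner[symmetric] inner_commute[of "E 0 w"])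
        then have "inner (E 0 w) (z *\<^sub>C A ?s) = 0"
          using FP[of 0 "Z ?s"] complex_linearD[OF F]
          by (simp add: A_def F_inner[symmetric] inner_commute[of "E 0 w"])
        then have "inner ?s ?s = inner (E 0 w) (E 0 w) + inner (z *\<^sub>C A ?s) (z *\<^sub>C A ?s)"
          by (subst (1 2) S[OF z]) (simp add: inner_add_left inner_add_right inner_commute)
        then have "(norm ?s)\<^sup>2 = (norm w)\<^sup>2 + (cmod z * norm (A ?s))\<^sup>2"
          using ortho[of 0 0 w w] by (simp add: power2_norm_eq_inner flip: norm_scaleC)
        moreover have "(cmod z * norm (A ?s))\<^sup>2 \<le> (1 * norm (A ?s))\<^sup>2"
          using z by (intro power_mono mult_right_mono) auto
        ultimately have "(norm (C' ?s))\<^sup>2 \<le> (norm w)\<^sup>2"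
          using A_le[of ?s] unfolding mult_1 by linarith
        then have "norm (C' ?s) \<le> norm w"
          by (rule power2_le_imp_le) simp
        then show "norm (V z w) \<le> 1 * norm w"
          by (simp add: V C')
      qed simp
    qed
  next
    fix z w assume z: "z \<in> \<bbbD>"
    let ?s = "S z w"
    define e where "e = F M (Z ?s)"
    \<comment> \<open>The signal enters cell \<open>M\<close> after one step and needs
      \<open>M - j\<close> more steps to cell \<open>j\<close>; hence the exponent
      \<open>Suc M - j\<close>.\<close>
    define b where "b j = z ^ (Suc M - j) *\<^sub>C E j e" for j
    (* The feedback signal e enters the delay line at its end; s' is the resulting state of the
       closed system, that is the solution of s' = t + z Z s'. *)
    define s' where "s' = ?s + (\<Sum>j<M. b (Suc j))"
    \<comment> \<open>In \<open>s'\<close> cell 0 holds \<open>w\<close> in total. The part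
      \<open>b 0\<close> arrives through the line, so the external input is the difference.\<close>
    define t where "t = E 0 (w - z ^ Suc M *\<^sub>C e)"
    have "Z ?s = A ?s + (\<Sum>j\<le>M. E j (F j (Z ?s)))"
      by (simp add: A_def P)
    also have "(\<Sum>j\<le>M. E j (F j (Z ?s))) = (\<Sum>j<M. E j (F j (Z ?s))) + E M e"
      by (simp add: e_def lessThan_Suc_atMost[symmetric])
    \<comment> \<open>By \<open>FZ\<close> the content arriving in cell \<open>j\<close> comes from
      cell \<open>Suc j\<close>, which is empty by \<open>FS\<close>.\<close>
    also have "(\<Sum>j<M. E j (F j (Z ?s))) = (\<Sum>j<M. 0)"
      using z by (intro sum.cong) (simp_all add: FZ FS)
    finally have ZS: "Z ?s = A ?s + E M e" by simp
    have "z *\<^sub>C Z (b (Suc j)) = b j" if "j < M" for j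
      using that by (simp add: b_def complex_linearD[OF Z] shift scaleC_scaleC Suc_diff_le)
    then have "z *\<^sub>C Z s' = z *\<^sub>C A ?s + b M + (\<Sum>j<M. b j)"
      by (simp add: s'_def blinfun.add_right blinfun.sum_right ZS scaleC_add_right scaleC_sum_right b_def)
    also have "\<dots> = z *\<^sub>C A ?s + (\<Sum>j<Suc M. b j)"
      by simp
    also have "(\<Sum>j<Suc M. b j) = b 0 + (\<Sum>j<M. b (Suc j))"
      by (rule sum.lessThan_Suc_shift)
    finally have "z *\<^sub>C Z s' = s' + b 0 - E 0 w"
      using S[OF z, of w] by (simp add: s'_def algebra_simps)
    moreover have "t = E 0 w - b 0"
      by (simp add: t_def b_def blinfun.diff_right complex_linearD[OF E])
    ultimately have step: "s' = t + z *\<^sub>C Z s'"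
      by simp
    have Zn_lin: "(blinfun_apply Z ^^ n) (x + y) = (blinfun_apply Z ^^ n) x + (blinfun_apply Z ^^ n) y"
      "(blinfun_apply Z ^^ n) (c *\<^sub>C x) = c *\<^sub>C (blinfun_apply Z ^^ n) x" for n x y c
      by (induction n) (simp_all add: blinfun.add_right complex_linearD[OF Z])
    have Zn_norm: "norm ((blinfun_apply Z ^^ n) x) \<le> norm x" for n x
      by (induction n) (auto intro: order_trans[OF Z_norm])
    \<comment> \<open>\<open>Z\<close> preserves the norm on the cells 1 to \<open>M\<close>, so the
      energy inequality \<open>contr\<close> leaves nothing for \<open>C\<close>.\<close>
    have CE: "C (E (Suc j) u) = 0" if "j < M" for j u
    proof -
      have "(norm (C (E (Suc j) u)))\<^sup>2 \<le> 0"
        using contr[of "E (Suc j) u"] ortho[of j j u u] ortho[of "Suc j" "Suc j" u u] that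
        by (simp add: shift power2_norm_eq_inner del: power2_less_eq_zero_iff)
      then show ?thesis by simp
    qed
    have Cs': "C s' = C ?s"
      by (simp add: s'_def blinfun.add_right blinfun.sum_right b_def complex_linearD[OF C] CE)
    \<comment> \<open>Iterating \<open>step\<close> produces the series; the remainder vanishes
      because \<open>cmod z < 1\<close> and \<open>Z\<close> is a contraction.\<close>
    have part: "s' = (\<Sum>k<n. z ^ k *\<^sub>C (blinfun_apply Z ^^ k) t) + z ^ n *\<^sub>C (blinfun_apply Z ^^ n) s'" for n
    proof (induction n)
      case (Suc n)
      note Suc
      also have "(blinfun_apply Z ^^ n) s' = (blinfun_apply Z ^^ n) t + z *\<^sub>C (blinfun_apply Z ^^ Suc n) s'"
        by (subst (1) step) (simp add: Zn_lin funpow_swap1)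
      finally show ?case
        by (simp add: scaleC_add_right scaleC_scaleC mult.commute add.assoc)
    qed simp
    have "(\<lambda>n. cmod z ^ n * norm s') \<longlonglongrightarrow> 0"
      using z by (intro tendsto_mult_left_zero LIMSEQ_power_zero) simp
    then have "(\<lambda>n. z ^ n *\<^sub>C (blinfun_apply Z ^^ n) s') \<longlonglongrightarrow> 0"
      by (rule Lim_null_comparison[rotated])
         (simp add: norm_scaleC norm_power mult_left_mono Zn_norm)
    then have "(\<lambda>n. s' - z ^ n *\<^sub>C (blinfun_apply Z ^^ n) s') \<longlonglongrightarrow> s' - 0"
      by (intro tendsto_intros)
    moreover have "s' - z ^ n *\<^sub>C (blinfun_apply Z ^^ n) s' = (\<Sum>k<n. z ^ k *\<^sub>C (blinfun_apply Z ^^ k) t)" for n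
      by (subst (1) part[of n]) simp
    ultimately have "(\<lambda>k. z ^ k *\<^sub>C (blinfun_apply Z ^^ k) t) sums s'"
      by (simp add: sums_def)
    then have "(\<lambda>k. C (z ^ k *\<^sub>C (blinfun_apply Z ^^ k) t)) sums C s'"
      by (rule bounded_linear.sums[OF blinfun.bounded_linear_right])
    then show "(\<lambda>n. z ^ n *\<^sub>C C ((blinfun_apply Z ^^ n) (E 0 (w - z ^ Suc M *\<^sub>C snd (V z w))))) sums fst (V z w)"
      by (simp add: V Cs' complex_linearD[OF C] t_def e_def)
  qed
qed

section \<open>Means over circles\<close>

text \<open>Cauchy's integral formula at the centre, parametrised by the angle.\<close>

lemma has_integral_circle_mean:
  assumes f: "f holomorphic_on \<bbbD>" and r: "0 < r" "r < 1"
  shows "((\<lambda>t. f (complex_of_real r * cis t)) has_integral 2 * of_real pi * f 0) {0..2 * pi}"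
proof -
  have "f holomorphic_on cball 0 r"
    using f r by (intro holomorphic_on_subset[OF f]) auto
  then have "((\<lambda>u. f u / (u - 0)) has_contour_integral 2 * of_real pi * \<i> * f 0) (circlepath 0 r)"
    using r by (intro Cauchy_integral_circlepath_simple) auto
  then have "((\<lambda>t. f (0 + r * cis t) / (0 + r * cis t - 0) * r * \<i> * cis t)
      has_integral 2 * of_real pi * \<i> * f 0) {0..2 * pi}"
    unfolding circlepath_def by (subst (asm) has_contour_integral_part_circlepath_iff) simp_all
  then have "((\<lambda>t. - \<i> * (f (0 + r * cis t) / (0 + r * cis t - 0) * r * \<i> * cis t))
      has_integral - \<i> * (2 * of_real pi * \<i> * f 0)) {0..2 * pi}"
    by (rule has_integral_mult_right)
  then show ?thesis
    using r by (simp add: field_simps)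
qed

text \<open>Left without the factor \<open>1 / (2 * pi)\<close>, hence the \<open>2 * pi\<close> in
  front of the coefficient sums below.\<close>

definition circle_norm2 :: "real \<Rightarrow> (complex \<Rightarrow> 'a::real_normed_vector) \<Rightarrow> real"
  where "circle_norm2 r f = integral {0..2 * pi} (\<lambda>t. (norm (f (complex_of_real r * cis t)))\<^sup>2)"

text \<open>Continuity is asked off the origin only, which suits quotients such as
  \<open>(h z - a 0) / z\<close>.\<close>

lemma circle_norm2_integrable:
  fixes f :: "complex \<Rightarrow> 'a::real_normed_vector"
  assumes r: "0 < r" "r < 1" and f: "continuous_on (\<bbbD> - {0}) f"
  shows "(\<lambda>t. (norm (f (complex_of_real r * cis t)))\<^sup>2) integrable_on {0..2 * pi}"
proof (rule integrable_continuous_interval)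
  have "continuous_on {0..2 * pi} (\<lambda>t. f (complex_of_real r * cis t))"
    using r by (intro continuous_on_compose2[OF f] continuous_intros) (auto simp: norm_mult)
  then show "continuous_on {0..2 * pi} (\<lambda>t. (norm (f (complex_of_real r * cis t)))\<^sup>2)"
    by (intro continuous_intros)
qed

text \<open>The cross term is twice the real part of the mean of \<open>z * cinner (q z) a\<close>,
  which vanishes by the mean value property.\<close>

lemma circle_norm2_shift:
  fixes q :: "complex \<Rightarrow> 'a::complex_hilbert_space"
  assumes r: "0 < r" "r < 1" and cont: "continuous_on (\<bbbD> - {0}) q"
    and hol: "\<And>b. (\<lambda>z. cinner (q z) b) holomorphic_on \<bbbD>"
  shows "circle_norm2 r (\<lambda>z. a + z *\<^sub>C q z) = 2 * pi * (norm a)\<^sup>2 + r\<^sup>2 * circle_norm2 r q"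
proof -
  let ?z = "\<lambda>t. complex_of_real r * cis t"
  have "((\<lambda>t. ?z t * cinner (q (?z t)) a) has_integral 2 * of_real pi * (0 * cinner (q 0) a)) {0..2 * pi}"
    using has_integral_circle_mean[of "\<lambda>z. z * cinner (q z) a", OF _ r] hol[of a]
    by (simp add: holomorphic_on_mult)
  from has_integral_linear[OF this bounded_linear_Re]
  have "((\<lambda>t. Re (?z t * cinner (q (?z t)) a)) has_integral 0) {0..2 * pi}"
    by (simp only: o_def mult_zero_left mult_zero_right zero_complex.sel)
  then have cross: "((\<lambda>t. 2 * Re (?z t * cinner (q (?z t)) a)) has_integral 2 * 0) {0..2 * pi}"
    by (rule has_integral_mult_right)
  have const: "((\<lambda>t. (norm a)\<^sup>2) has_integral (2 * pi) * (norm a)\<^sup>2) {0..2 * pi}"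
    using has_integral_const_real[of "(norm a)\<^sup>2" 0 "2 * pi"] by simp
  have "((\<lambda>t. (norm (q (?z t)))\<^sup>2) has_integral circle_norm2 r q) {0..2 * pi}"
    unfolding circle_norm2_def
    by (rule integrable_integral[OF circle_norm2_integrable[OF r cont]])
  then have main: "((\<lambda>t. r\<^sup>2 * (norm (q (?z t)))\<^sup>2) has_integral r\<^sup>2 * circle_norm2 r q) {0..2 * pi}"
    by (rule has_integral_mult_right)
  have "(norm (a + ?z t *\<^sub>C q (?z t)))\<^sup>2
      = (norm a)\<^sup>2 + 2 * Re (?z t * cinner (q (?z t)) a) + r\<^sup>2 * (norm (q (?z t)))\<^sup>2" for t
  proof -
    have "(norm (?z t *\<^sub>C q (?z t)))\<^sup>2 = r\<^sup>2 * (norm (q (?z t)))\<^sup>2"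
      using r by (simp add: norm_scaleC norm_mult power_mult_distrib)
    moreover have "inner (?z t *\<^sub>C q (?z t)) a = Re (?z t * cinner (q (?z t)) a)"
      by (simp only: Re_cinner[symmetric] cinner_scaleC_left)
    moreover have "(norm (a + b))\<^sup>2 = (norm a)\<^sup>2 + 2 * inner b a + (norm b)\<^sup>2" for b
      by (simp add: power2_norm_eq_inner inner_add_left inner_add_right inner_commute)
    ultimately show ?thesis by simp
  qed
  then have "((\<lambda>t. (norm (a + ?z t *\<^sub>C q (?z t)))\<^sup>2) has_integral
      (2 * pi) * (norm a)\<^sup>2 + 2 * 0 + r\<^sup>2 * circle_norm2 r q) {0..2 * pi}"
    using has_integral_add[OF has_integral_add[OF const cross] main] by simp
  then show ?thesis
    unfolding circle_norm2_def by (simp add: integral_unique)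
qed

text \<open>Peeling off the constant coefficient writes the function as
  \<open>u 0 + z *\<^sub>C q z\<close>, where \<open>q\<close> has the same form with the
  coefficients shifted.\<close>

lemma circle_norm2_polynomial:
  fixes f :: "complex \<Rightarrow> 'a::complex_hilbert_space"
  assumes r: "0 < r" "r < 1" and f: "f cholomorphic_on \<bbbD>"
  shows "circle_norm2 r (\<lambda>z. (\<Sum>j<N. z ^ j *\<^sub>C u j) + z ^ N *\<^sub>C f z)
    = 2 * pi * (\<Sum>j<N. r ^ (2 * j) * (norm (u j))\<^sup>2) + r ^ (2 * N) * circle_norm2 r f"
proof (induction N arbitrary: u)
  case (Suc N)
  define q where "q z = (\<Sum>j<N. z ^ j *\<^sub>C u (Suc j)) + z ^ N *\<^sub>C f z" for z
  have q: "q cholomorphic_on \<bbbD>"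
    unfolding q_def
    by (intro cholomorphic_on_add cholomorphic_on_sum cholomorphic_on_scaleC cholomorphic_on_const f
        holomorphic_intros)
  have "(\<Sum>j<Suc N. z ^ j *\<^sub>C u j) + z ^ Suc N *\<^sub>C f z = u 0 + z *\<^sub>C q z" for z
    by (simp add: q_def sum.lessThan_Suc_shift scaleC_add_right scaleC_sum_right scaleC_scaleC
        add.assoc del: sum.lessThan_Suc)
  then have "circle_norm2 r (\<lambda>z. (\<Sum>j<Suc N. z ^ j *\<^sub>C u j) + z ^ Suc N *\<^sub>C f z)
      = circle_norm2 r (\<lambda>z. u 0 + z *\<^sub>C q z)"
    by simp
  also have "\<dots> = 2 * pi * (norm (u 0))\<^sup>2 + r\<^sup>2 * circle_norm2 r q"
    using continuous_on_subset[OF cholomorphic_on_imp_continuous_on[OF q]] cholomorphic_on_cinner[OF q]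
    by (intro circle_norm2_shift r) auto
  also have "circle_norm2 r q
      = 2 * pi * (\<Sum>j<N. r ^ (2 * j) * (norm (u (Suc j)))\<^sup>2) + r ^ (2 * N) * circle_norm2 r f"
    unfolding q_def by (rule Suc)
  finally show ?case
    by (simp add: sum.lessThan_Suc_shift sum_distrib_left power2_eq_square algebra_simps
        del: sum.lessThan_Suc)
qed simp

text \<open>A Bessel inequality, obtained by splitting off one coefficient at a time; the quotient
  \<open>(h z - a 0) / z\<close> has the shifted coefficients.\<close>

lemma circle_norm2_ge_coefficients:
  fixes h :: "complex \<Rightarrow> 'a::complex_hilbert_space"
  assumes r: "0 < r" "r < 1" and cont: "continuous_on (\<bbbD> - {0}) h"
    and sums: "\<And>z. z \<in> \<bbbD> \<Longrightarrow> (\<lambda>n. z ^ n *\<^sub>C a n) sums h z"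
  shows "2 * pi * (\<Sum>m<K. r ^ (2 * m) * (norm (a m))\<^sup>2) \<le> circle_norm2 r h"
  using cont sums
proof (induction K arbitrary: h a)
  case 0
  then show ?case
    unfolding circle_norm2_def
    by (simp add: integral_nonneg circle_norm2_integrable[OF r])
next
  case (Suc K)
  \<comment> \<open>The value at 0 is the constant term of the quotient series, so that the
    expansion holds on the whole disc.\<close>
  define f where "f z = (if z = 0 then a 1 else inverse z *\<^sub>C (h z - a 0))" for z
  have f_sums: "(\<lambda>n. z ^ n *\<^sub>C a (Suc n)) sums f z" if z: "z \<in> \<bbbD>" for z
  proof (cases "z = 0")
    case True
    have "(\<lambda>n. z ^ n *\<^sub>C a (Suc n)) sums (\<Sum>n\<in>{0}. z ^ n *\<^sub>C a (Suc n))"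
      by (rule sums_finite) (auto simp: True power_0_left)
    then show ?thesis by (simp add: True f_def)
  next
    case False
    have "(\<lambda>n. z ^ Suc n *\<^sub>C a (Suc n)) sums (h z - z ^ 0 *\<^sub>C a 0)"
      using Suc.prems(2)[OF z] sums_Suc_iff[of "\<lambda>n. z ^ n *\<^sub>C a n" "h z - z ^ 0 *\<^sub>C a 0"]
      by (simp only: diff_add_cancel)
    then have "(\<lambda>n. inverse z *\<^sub>C (z ^ Suc n *\<^sub>C a (Suc n))) sums (inverse z *\<^sub>C (h z - z ^ 0 *\<^sub>C a 0))"
      by (rule bounded_linear.sums[OF bounded_linear_scaleC_right])
    then show ?thesis
      using False by (simp add: f_def scaleC_scaleC flip: mult.assoc)
  qed
  have "z *\<^sub>C f z = h z - a 0" if "z \<in> \<bbbD>" for z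
  proof (cases "z = 0")
    case True
    have "(\<lambda>n. z ^ n *\<^sub>C a n) sums (\<Sum>n\<in>{0}. z ^ n *\<^sub>C a n)"
      by (rule sums_finite) (auto simp: True power_0_left)
    then have "h z = a 0"
      using sums_unique2 Suc.prems(2)[OF that] by (fastforce simp: True)
    then show ?thesis by (simp add: True)
  qed (simp add: f_def scaleC_scaleC)
  then have h: "h z = a 0 + z *\<^sub>C f z" if "z \<in> \<bbbD>" for z
    using that by simp
  have f_cont: "continuous_on (\<bbbD> - {0}) f"
  proof -
    have "continuous_on (\<bbbD> - {0}) (\<lambda>z. inverse z *\<^sub>C (h z - a 0))"
      by (intro continuous_on_scaleC continuous_intros Suc.prems(1)) auto
    then show ?thesis
      by (rule continuous_on_eq) (simp add: f_def)
  qed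
  \<comment> \<open>Continuity of \<open>f\<close> has been shown off 0 only, but its pairing with
    \<open>b\<close> is a scalar power series on the whole disc and so holomorphic at 0 as
    well.\<close>
  have "(\<lambda>z. cinner (f z) b) holomorphic_on ball 0 1" for b
  proof (rule power_series_holomorphic)
    fix w :: complex assume "w \<in> ball 0 1"
    from bounded_linear.sums[OF bounded_linear_cinner_left f_sums[OF this], of b]
    show "(\<lambda>n. cinner (a (Suc n)) b * (w - 0) ^ n) sums cinner (f w) b"
      by (simp add: cinner_scaleC_left mult.commute)
  qed
  then have "circle_norm2 r (\<lambda>z. a 0 + z *\<^sub>C f z) = 2 * pi * (norm (a 0))\<^sup>2 + r\<^sup>2 * circle_norm2 r f"
    by (intro circle_norm2_shift r f_cont)
  moreover have "circle_norm2 r (\<lambda>z. a 0 + z *\<^sub>C f z) = circle_norm2 r h"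
    unfolding circle_norm2_def using r h by (simp add: norm_mult)
  moreover have "2 * pi * (\<Sum>m<K. r ^ (2 * m) * (norm (a (Suc m)))\<^sup>2) \<le> circle_norm2 r f"
    by (rule Suc.IH[OF f_cont f_sums])
  then have "r\<^sup>2 * (2 * pi * (\<Sum>m<K. r ^ (2 * m) * (norm (a (Suc m)))\<^sup>2)) \<le> r\<^sup>2 * circle_norm2 r f"
    by (rule mult_left_mono) simp
  moreover have "2 * pi * (\<Sum>m<Suc K. r ^ (2 * m) * (norm (a m))\<^sup>2)
      = 2 * pi * (norm (a 0))\<^sup>2 + r\<^sup>2 * (2 * pi * (\<Sum>m<K. r ^ (2 * m) * (norm (a (Suc m)))\<^sup>2))"
    by (simp add: sum.lessThan_Suc_shift sum_distrib_left power2_eq_square algebra_simps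
        del: sum.lessThan_Suc)
  ultimately show ?case by linarith
qed

section \<open>Sufficiency: the Toeplitz contraction from a Schur function\<close>

lemma feedback_norm_less_1:
  fixes A :: "'u::complex_hilbert_space \<Rightarrow>\<^sub>L ('y::complex_hilbert_space \<times> 'u)"
  assumes z: "z \<in> \<bbbD>" and A: "norm A \<le> 1" and N: "N > 0"
  shows "norm (z ^ N *\<^sub>C (snd_blinfun o\<^sub>L A)) < 1"
proof -
  have "norm (snd_blinfun o\<^sub>L A) \<le> 1"
  proof (rule norm_blinfun_bound)
    show "norm ((snd_blinfun o\<^sub>L A) x) \<le> 1 * norm x" for x
      using norm_snd_le[of "snd (A x)" "fst (A x)"] norm_blinfun_le_1D[OF A, of x] by simp
  qed simp
  then have "cmod z ^ N * norm (snd_blinfun o\<^sub>L A) \<le> cmod z ^ N"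
    by (intro mult_left_le) simp_all
  also have "cmod z ^ N < 1"
    using z N by (intro power_less_one_iff[THEN iffD2]) simp_all
  finally show ?thesis by (simp add: norm_scaleC norm_power)
qed

text \<open>On polynomials of degree below \<open>N\<close> the Toeplitz matrix is multiplication by
  \<open>H\<close>: column \<open>j\<close> is the coefficient sequence of \<open>H\<close> delayed
  by \<open>j\<close>.\<close>

lemma block_toeplitz_sums:
  assumes A: "taylor_coeffs_at_0 H A" and z: "z \<in> \<bbbD>"
  shows "(\<lambda>m. z ^ m *\<^sub>C block_toeplitz N A u m) sums (\<Sum>j<N. z ^ j *\<^sub>C H z (u j))"
proof -
  have "(\<lambda>m. if j \<le> m then z ^ m *\<^sub>C A (m - j) (u j) else 0) sums (z ^ j *\<^sub>C H z (u j))" for j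
  proof -
    have "(\<lambda>n. z ^ n *\<^sub>C A n (u j)) sums H z (u j)"
      using A z by (simp add: taylor_coeffs_at_0_def)
    then have "(\<lambda>n. z ^ j *\<^sub>C (z ^ n *\<^sub>C A n (u j))) sums (z ^ j *\<^sub>C H z (u j))"
      by (rule bounded_linear.sums[OF bounded_linear_scaleC_right])
    then have "(\<lambda>n. (\<lambda>m. if j \<le> m then z ^ m *\<^sub>C A (m - j) (u j) else 0) (n + j)) sums (z ^ j *\<^sub>C H z (u j))"
      by (simp add: scaleC_scaleC power_add mult.commute)
    then show ?thesis
      by (subst (asm) sums_zero_iff_shift) auto
  qed
  then have "(\<lambda>m. \<Sum>j<N. if j \<le> m then z ^ m *\<^sub>C A (m - j) (u j) else 0) sums (\<Sum>j<N. z ^ j *\<^sub>C H z (u j))"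
    by (rule sums_sum)
  moreover have "(\<Sum>j<N. if j \<le> m then z ^ m *\<^sub>C A (m - j) (u j) else 0) = z ^ m *\<^sub>C block_toeplitz N A u m" for m
    unfolding block_toeplitz_def scaleC_sum_right by (rule sum.cong) auto
  ultimately show ?thesis by simp
qed

lemma contraction_if_feedback:
  fixes V :: "complex \<Rightarrow> 'u::complex_hilbert_space \<Rightarrow>\<^sub>L ('y::complex_hilbert_space \<times> 'u)"
  assumes N: "N > 0" and taylor: "taylor_coeffs_at_0 H A" and V: "V \<in> schur_class"
    and H: "\<And>z. z \<in> \<bbbD> \<Longrightarrow>
      H z = fst_blinfun o\<^sub>L V z o\<^sub>L blinfun_inverse (id_blinfun - z ^ N *\<^sub>C (snd_blinfun o\<^sub>L V z))"
  shows "contraction_to_l2 N (block_toeplitz N A)"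
  unfolding contraction_to_l2_def
proof
  fix u :: "nat \<Rightarrow> 'u"
  have V_hol: "V cholomorphic_on \<bbbD>" and V_lin: "\<And>z. z \<in> \<bbbD> \<Longrightarrow> complex_linear (V z)"
    and V_norm: "\<And>z. z \<in> \<bbbD> \<Longrightarrow> norm (V z) \<le> 1"
    using V by (auto simp: schur_class_def)
  define W where "W z = z ^ N *\<^sub>C (snd_blinfun o\<^sub>L V z)" for z
  define R where "R z = blinfun_inverse (id_blinfun - W z)" for z
  have W_norm: "norm (W z) < 1" if "z \<in> \<bbbD>" for z
    unfolding W_def by (rule feedback_norm_less_1[OF that V_norm[OF that] N])
  have W_lin: "complex_linear (W z)" if "z \<in> \<bbbD>" for z
    unfolding W_def
    by (intro complex_linear_scaleC complex_linear_compose complex_linear_snd V_lin[OF that])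
  have "W cholomorphic_on \<bbbD>"
    unfolding W_def
    by (intro cholomorphic_on_scaleC cholomorphic_on_blinfun_compose cholomorphic_on_const V_hol
        complex_linear_snd holomorphic_intros)
  then have R_hol: "R cholomorphic_on \<bbbD>"
    unfolding R_def using W_norm W_lin by (rule cholomorphic_on_blinfun_inverse)
  have R_lin: "complex_linear (R z)" if "z \<in> \<bbbD>" for z
    unfolding R_def by (rule complex_linear_blinfun_inverse[OF W_norm[OF that] W_lin[OF that]])
  define p where "p z = (\<Sum>j<N. z ^ j *\<^sub>C u j)" for z
  define g where "g z = R z (p z)" for z
  define f where "f z = snd (V z (g z))" for z
  define h where "h z = fst (V z (g z))" for z
  have p_hol: "p cholomorphic_on \<bbbD>"
    unfolding p_def
    by (intro cholomorphic_on_sum cholomorphic_on_scaleC cholomorphic_on_const holomorphic_intros)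
  have g_hol: "g cholomorphic_on \<bbbD>"
    unfolding g_def by (intro cholomorphic_on_blinfun_apply R_hol p_hol R_lin)
  have Vg_hol: "(\<lambda>z. V z (g z)) cholomorphic_on \<bbbD>"
    by (intro cholomorphic_on_blinfun_apply V_hol g_hol V_lin)
  have f_hol: "f cholomorphic_on \<bbbD>"
    unfolding f_def
    using cholomorphic_on_blinfun_apply[OF cholomorphic_on_const Vg_hol, of snd_blinfun]
    by (simp add: complex_linear_snd)
  have h_hol: "h cholomorphic_on \<bbbD>"
    unfolding h_def
    using cholomorphic_on_blinfun_apply[OF cholomorphic_on_const Vg_hol, of fst_blinfun]
    by (simp add: complex_linear_fst)
  have g_eq: "g z = p z + z ^ N *\<^sub>C f z" if "z \<in> \<bbbD>" for z
    using blinfun_inverse_fixpoint[OF W_norm[OF that], of "p z"]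
    by (simp add: g_def R_def f_def W_def scaleC_blinfun.rep_eq diff_eq_eq)
  have energy: "(norm (h z))\<^sup>2 + (norm (f z))\<^sup>2 \<le> (norm (g z))\<^sup>2" if "z \<in> \<bbbD>" for z
  proof -
    have "(norm (h z))\<^sup>2 + (norm (f z))\<^sup>2 = (norm (V z (g z)))\<^sup>2"
      by (simp add: h_def f_def norm_prod_def)
    also have "\<dots> \<le> (norm (g z))\<^sup>2"
      by (intro power_mono norm_blinfun_le_1D V_norm that norm_ge_zero)
    finally show ?thesis .
  qed
  have cont: "continuous_on (\<bbbD> - {0}) h" "continuous_on (\<bbbD> - {0}) f" "continuous_on (\<bbbD> - {0}) g"
    using h_hol f_hol g_hol by (auto intro: continuous_on_subset cholomorphic_on_imp_continuous_on)
  have h_sums: "(\<lambda>m. z ^ m *\<^sub>C block_toeplitz N A u m) sums h z" if z: "z \<in> \<bbbD>" for z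
  proof -
    have "h z = H z (p z)"
      by (simp add: H[OF z] h_def g_def R_def W_def)
    also have "\<dots> = (\<Sum>j<N. z ^ j *\<^sub>C H z (u j))"
    proof -
      have "complex_linear (H z)"
        using complex_linear_compose[OF complex_linear_compose[OF complex_linear_fst V_lin[OF z]] R_lin[OF z]]
        by (simp add: H[OF z] R_def W_def)
      then show ?thesis
        by (simp add: p_def blinfun.sum_right complex_linearD)
    qed
    finally show ?thesis
      using block_toeplitz_sums[OF taylor z] by simp
  qed
  \<comment> \<open>For fixed \<open>r < 1\<close> the mean of \<open>f\<close> is a real number and
    cancels from both sides, so no bound on it uniform in \<open>r\<close> enters.\<close>
  have bound: "(\<Sum>m<K. r ^ (2 * m) * (norm (block_toeplitz N A u m))\<^sup>2) \<le> (\<Sum>j<N. (norm (u j))\<^sup>2)"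
    if r: "0 < r" "r < 1" for r :: real and K
  proof -
    have "circle_norm2 r h + circle_norm2 r f
        = integral {0..2 * pi} (\<lambda>t. (norm (h (complex_of_real r * cis t)))\<^sup>2
            + (norm (f (complex_of_real r * cis t)))\<^sup>2)"
      unfolding circle_norm2_def
      by (intro integral_add[symmetric] circle_norm2_integrable r cont)
    also have "\<dots> \<le> circle_norm2 r g"
      unfolding circle_norm2_def using r
      by (intro integral_le integrable_add circle_norm2_integrable cont energy) (simp_all add: norm_mult)
    also have "circle_norm2 r g = circle_norm2 r (\<lambda>z. p z + z ^ N *\<^sub>C f z)"
      unfolding circle_norm2_def using r g_eq by (simp add: norm_mult)
    also have "\<dots> = 2 * pi * (\<Sum>j<N. r ^ (2 * j) * (norm (u j))\<^sup>2) + r ^ (2 * N) * circle_norm2 r f"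
      unfolding p_def by (rule circle_norm2_polynomial[OF r f_hol])
    also have "\<dots> \<le> 2 * pi * (\<Sum>j<N. (norm (u j))\<^sup>2) + circle_norm2 r f"
    proof (intro add_mono mult_left_mono sum_mono)
      have le_1: "r ^ k \<le> 1" for k
        using r by (simp add: power_le_one)
      show "r ^ (2 * j) * (norm (u j))\<^sup>2 \<le> (norm (u j))\<^sup>2" for j
        using le_1 by (simp add: mult_left_le_one_le r(1) less_imp_le)
      have "0 \<le> circle_norm2 r f"
        unfolding circle_norm2_def by (intro integral_nonneg circle_norm2_integrable r cont) simp
      then show "r ^ (2 * N) * circle_norm2 r f \<le> circle_norm2 r f"
        using le_1 by (simp add: mult_left_le_one_le r(1) less_imp_le)
    qed simp
    finally have "circle_norm2 r h \<le> 2 * pi * (\<Sum>j<N. (norm (u j))\<^sup>2)"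
      by simp
    then have "2 * pi * (\<Sum>m<K. r ^ (2 * m) * (norm (block_toeplitz N A u m))\<^sup>2)
        \<le> 2 * pi * (\<Sum>j<N. (norm (u j))\<^sup>2)"
      using circle_norm2_ge_coefficients[OF r cont(1) h_sums, of K] by linarith
    then show ?thesis by simp
  qed
  \<comment> \<open>The limit \<open>r \<rightarrow> 1\<close> is taken in finite sums, so no
    boundary values are involved.\<close>
  have part: "(\<Sum>m<K. (norm (block_toeplitz N A u m))\<^sup>2) \<le> (\<Sum>j<N. (norm (u j))\<^sup>2)" for K
  proof -
    have "((\<lambda>r. \<Sum>m<K. r ^ (2 * m) * (norm (block_toeplitz N A u m))\<^sup>2) \<longlongrightarrow>
        (\<Sum>m<K. 1 ^ (2 * m) * (norm (block_toeplitz N A u m))\<^sup>2)) (at_left (1::real))"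
      by (intro tendsto_intros)
    moreover have "eventually (\<lambda>r. (\<Sum>m<K. r ^ (2 * m) * (norm (block_toeplitz N A u m))\<^sup>2)
        \<le> (\<Sum>j<N. (norm (u j))\<^sup>2)) (at_left (1::real))"
      using eventually_at_left_real[OF zero_less_one] by eventually_elim (auto intro: bound)
    ultimately show ?thesis
      using tendsto_upperbound[of _ _ "at_left (1::real)"] by fastforce
  qed
  have summable: "summable (\<lambda>m. (norm (block_toeplitz N A u m))\<^sup>2)"
    by (intro bounded_imp_summable[of _ "\<Sum>j<N. (norm (u j))\<^sup>2"])
       (simp_all only: part lessThan_Suc_atMost[symmetric] zero_le_power2)
  then have "(\<Sum>m. (norm (block_toeplitz N A u m))\<^sup>2) \<le> (\<Sum>j<N. (norm (u j))\<^sup>2)"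
    using part by (intro suminf_le_const) (simp_all add: atLeast0LessThan)
  then show "block_toeplitz N A u \<in> l2_seq \<and> l2_norm (block_toeplitz N A u) \<le> direct_sum_norm N u"
    using summable by (simp add: l2_seq_def l2_norm_def direct_sum_norm_def L2_set_def)
qed

section \<open>Toeplitz operators as delay lines\<close>

lemma powser_coeff_zero:
  fixes a :: "nat \<Rightarrow> 'a::complex_hilbert_space"
  assumes sums: "\<And>z. z \<in> \<bbbD> \<Longrightarrow> (\<lambda>n. z ^ n *\<^sub>C a n) sums 0"
  shows "a m = 0"
proof -
  \<comment> \<open>Pairing with \<open>a m\<close> itself gives a scalar series whose coefficient
    of index \<open>m\<close> is the squared norm of \<open>a m\<close>.\<close>
  define b where "b n = cinner (a n) (a m)" for n
  have b_sums: "(\<lambda>n. b n * (z - 0) ^ n) sums 0" if "norm (z - 0) < 1" for z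
    using bounded_linear.sums[OF bounded_linear_cinner_left sums, of z "a m"] that
    by (simp add: b_def cinner_scaleC_left mult.commute
        linear_0[OF bounded_linear.linear[OF bounded_linear_cinner_left]])
  have "b m = 0"
  proof (cases "m = 0")
    case True
    then show ?thesis
      using b_sums[of 0] powser_sums_zero_iff[of b 0] by simp
  next
    case False
    show ?thesis
    proof (rule ccontr)
      assume "b m \<noteq> 0"
      \<comment> \<open>Zeros of a nontrivial power series are isolated; as the sum here is
        constantly 0, a punctured disc free of zeros is absurd.\<close>
      then obtain s where s: "0 < s" "\<And>z::complex. z \<in> cball 0 s - {0} \<Longrightarrow> False"
        using powser_0_nonzero[of 1 0 b "\<lambda>_. 0" m] b_sums False by auto
      then show False
        using s(2)[of "of_real s"] by auto
    qed
  qed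
  then have "inner (a m) (a m) = 0"
    by (simp add: b_def flip: Re_cinner)
  then show ?thesis by simp
qed

text \<open>The coefficients are given as real-linear operators; complex linearity passes to them
  from \<open>H\<close> because coefficients are unique.\<close>

lemma complex_linear_taylor_coeff:
  assumes H: "\<And>z. z \<in> \<bbbD> \<Longrightarrow> complex_linear (H z)" and taylor: "taylor_coeffs_at_0 H A"
  shows "complex_linear (A n)"
  unfolding complex_linear_def
proof (intro allI)
  fix c u
  have "A n (c *\<^sub>C u) - c *\<^sub>C A n u = 0"
  proof (rule powser_coeff_zero)
    fix z :: complex assume z: "z \<in> \<bbbD>"
    have s: "(\<lambda>n. z ^ n *\<^sub>C A n u) sums H z u" for u
      using taylor z by (simp add: taylor_coeffs_at_0_def)
    have "(\<lambda>n. z ^ n *\<^sub>C A n (c *\<^sub>C u) - c *\<^sub>C (z ^ n *\<^sub>C A n u)) sums (H z (c *\<^sub>C u) - c *\<^sub>C H z u)"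
      by (intro sums_diff s bounded_linear.sums[OF bounded_linear_scaleC_right])
    then show "(\<lambda>n. z ^ n *\<^sub>C (A n (c *\<^sub>C u) - c *\<^sub>C A n u)) sums 0"
      by (simp add: complex_linearD[OF H[OF z]] scaleC_diff_right scaleC_scaleC mult.commute)
  qed
  then show "A n (c *\<^sub>C u) = c *\<^sub>C A n u" by simp
qed

section \<open>The block Toeplitz operator on square summable sequences\<close>

lemma block_toeplitz_add:
  "block_toeplitz N A (\<lambda>j. u j + v j) m = block_toeplitz N A u m + block_toeplitz N A v m"
  unfolding block_toeplitz_def sum.distrib[symmetric]
  by (rule sum.cong) (auto simp: blinfun.add_right)

lemma block_toeplitz_scaleC:
  assumes "\<And>n. complex_linear (A n)"
  shows "block_toeplitz N A (\<lambda>j. c *\<^sub>C u j) m = c *\<^sub>C block_toeplitz N A u m"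
  unfolding block_toeplitz_def scaleC_sum_right
  by (rule sum.cong) (auto simp: complex_linearD[OF assms])

text \<open>The space of \<open>N\<close>-tuples is embedded in the full sequence space, of which
  \<open>T\<close> reads the first \<open>N\<close> entries; the domain is then a type independent
  of \<open>N\<close>.\<close>

lemma block_toeplitz_operator:
  assumes lin: "\<And>n. complex_linear (A n)" and contr: "contraction_to_l2 N (block_toeplitz N A)"
  obtains T :: "'u::complex_hilbert_space l2 \<Rightarrow>\<^sub>L 'y::complex_hilbert_space l2"
  where "complex_linear T" "norm T \<le> 1" "\<And>u m. l2_nth (T u) m = block_toeplitz N A (l2_nth u) m"
proof -
  define t where "t u = Abs_l2 (block_toeplitz N A (l2_nth u))" for u :: "'u l2"
  have mem: "block_toeplitz N A (l2_nth u) \<in> l2_seq" for u :: "'u l2"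
    using contr by (simp add: contraction_to_l2_def)
  then have nth: "l2_nth (t u) m = block_toeplitz N A (l2_nth u) m" for u m
    by (simp add: t_def l2_nth_Abs)
  have t_scaleC: "t (c *\<^sub>C u) = c *\<^sub>C t u" for c u
  proof -
    have "l2_nth (c *\<^sub>C u) = (\<lambda>j. c *\<^sub>C l2_nth u j)" by (rule ext) simp
    then show ?thesis by (intro l2_eqI) (simp add: nth block_toeplitz_scaleC[of A, OF lin])
  qed
  have t_norm: "norm (t u) \<le> norm u * 1" for u
  proof -
    have "norm (t u) = l2_norm (block_toeplitz N A (l2_nth u))"
      by (simp add: norm_l2_def t_def l2_nth_Abs mem)
    also have "\<dots> \<le> direct_sum_norm N (l2_nth u)"
      using contr by (simp add: contraction_to_l2_def)
    also have "\<dots> \<le> norm u"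
      unfolding direct_sum_norm_def L2_set_def by (intro real_le_lsqrt sum_norm_l2_le) simp_all
    finally show ?thesis by simp
  qed
  have "bounded_linear t"
  proof (rule bounded_linear_intro[OF _ _ t_norm])
    show "t (u + v) = t u + t v" for u v
    proof -
      have "l2_nth (u + v) = (\<lambda>j. l2_nth u j + l2_nth v j)" by (rule ext) simp
      then show ?thesis by (intro l2_eqI) (simp add: nth block_toeplitz_add)
    qed
    show "t (r *\<^sub>R u) = r *\<^sub>R t u" for r u
      by (simp add: scaleR_scaleC t_scaleC)
  qed
  then have ap: "blinfun_apply (Blinfun t) u = t u" for u
    by (simp add: bounded_linear_Blinfun_apply)
  show thesis
  proof (rule that)
    show "complex_linear (Blinfun t)"
      by (simp add: complex_linear_def ap t_scaleC)
    show "norm (Blinfun t) \<le> 1"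
      using t_norm by (intro norm_blinfun_bound) (simp_all add: ap)
  qed (simp add: ap nth)
qed

text \<open>Entries are constant along diagonals. Since \<open>u\<close> vanishes from index
  \<open>M\<close> on, its delay by one still fits into the \<open>Suc M\<close> columns.\<close>

lemma block_toeplitz_shift:
  assumes v0: "v 0 = 0" and shift: "\<And>m. v (Suc m) = u m" and u: "\<And>m. m \<ge> M \<Longrightarrow> u m = 0"
  shows "block_toeplitz (Suc M) A v 0 = 0"
    and "block_toeplitz (Suc M) A v (Suc m) = block_toeplitz (Suc M) A u m"
proof -
  show "block_toeplitz (Suc M) A v 0 = 0"
    unfolding block_toeplitz_def by (rule sum.neutral) (auto simp: v0)
  have "block_toeplitz (Suc M) A v (Suc m) = (\<Sum>j<M. if j \<le> m then A (m - j) (u j) else 0)"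
    unfolding block_toeplitz_def by (simp add: sum.lessThan_Suc_shift v0 shift del: sum.lessThan_Suc cong: if_cong)
  also have "\<dots> = block_toeplitz (Suc M) A u m"
    by (simp add: block_toeplitz_def u)
  finally show "block_toeplitz (Suc M) A v (Suc m) = block_toeplitz (Suc M) A u m" .
qed

section \<open>Backward shift and coordinate embeddings\<close>

definition l2_backshift :: "'a::complex_hilbert_space l2 \<Rightarrow>\<^sub>L 'a l2"
  where "l2_backshift = Blinfun (\<lambda>x. Abs_l2 (\<lambda>n. l2_nth x (Suc n)))"

lemma
  shows l2_nth_backshift [simp]: "l2_nth (l2_backshift (x::'a::complex_hilbert_space l2)) n = l2_nth x (Suc n)"
    and norm_l2_backshift: "(norm (l2_backshift x))\<^sup>2 + (norm (l2_nth x 0))\<^sup>2 = (norm x)\<^sup>2"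
proof -
  define s where "s x = Abs_l2 (\<lambda>n. l2_nth x (Suc n))" for x :: "'a l2"
  have "(\<lambda>n. l2_nth x (Suc n)) \<in> l2_seq" for x :: "'a l2"
    using l2_nth_mem[of x] summable_Suc_iff[of "\<lambda>n. (norm (l2_nth x n))\<^sup>2"] by (simp add: l2_seq_def)
  then have nth: "l2_nth (s x) n = l2_nth x (Suc n)" for x n
    by (simp add: s_def l2_nth_Abs)
  have norm_s: "(norm (s x))\<^sup>2 + (norm (l2_nth x 0))\<^sup>2 = (norm x)\<^sup>2" for x
  proof -
    have "(\<lambda>n. (norm (l2_nth x (Suc n)))\<^sup>2) sums (norm (s x))\<^sup>2"
      using sums_norm_l2[of "s x"] by (simp add: nth)
    then have "(\<lambda>n. (norm (l2_nth x n))\<^sup>2) sums ((norm (s x))\<^sup>2 + (norm (l2_nth x 0))\<^sup>2)"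
      by (simp only: sums_Suc_iff[of "\<lambda>n. (norm (l2_nth x n))\<^sup>2"] add_diff_cancel_right')
    then show ?thesis by (rule sums_unique2[OF _ sums_norm_l2])
  qed
  have "bounded_linear s"
  proof (rule bounded_linear_intro)
    show "s (x + y) = s x + s y" "s (r *\<^sub>R x) = r *\<^sub>R s x" for x y r
      by (rule l2_eqI, simp add: nth)+
    show "norm (s x) \<le> norm x * 1" for x
      unfolding mult_1_right by (rule power2_le_imp_le) (simp_all add: norm_s[of x, symmetric])
  qed
  then have ap: "blinfun_apply l2_backshift x = s x" for x
    by (simp add: l2_backshift_def s_def[abs_def, symmetric] bounded_linear_Blinfun_apply)
  show "l2_nth (l2_backshift x) n = l2_nth x (Suc n)"
    and "(norm (l2_backshift x))\<^sup>2 + (norm (l2_nth x 0))\<^sup>2 = (norm x)\<^sup>2"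
    by (simp_all add: ap nth norm_s)
qed

lemma norm_eq_if_shift:
  assumes "l2_nth v 0 = 0" "\<And>m. l2_nth v (Suc m) = l2_nth u m"
  shows "norm v = norm u"
proof -
  have "l2_backshift v = u"
    by (rule l2_eqI) (simp add: assms)
  then show ?thesis
    using norm_l2_backshift[of v] assms(1) by simp
qed

definition l2_single :: "nat \<Rightarrow> 'a::complex_hilbert_space \<Rightarrow>\<^sub>L 'a l2"
  where "l2_single j = Blinfun (\<lambda>u. Abs_l2 (\<lambda>n. if n = j then u else 0))"

lemma
  shows l2_nth_single [simp]: "l2_nth (l2_single j (u::'a::complex_hilbert_space)) n = (if n = j then u else 0)"
    and complex_linear_single: "complex_linear (l2_single j :: 'a \<Rightarrow>\<^sub>L 'a l2)"
proof -
  define s where "s u = Abs_l2 (\<lambda>n. if n = j then u else 0)" for u :: 'a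
  have sums: "(\<lambda>n. (norm (if n = j then u else 0))\<^sup>2) sums (norm u)\<^sup>2" for u :: 'a
    using sums_single[of j "\<lambda>_. (norm u)\<^sup>2"]
    by (rule sums_cong[THEN iffD1, rotated]) simp
  then have "(\<lambda>n. if n = j then u else 0) \<in> l2_seq" for u :: 'a
    by (auto simp: l2_seq_def sums_iff)
  then have nth: "l2_nth (s u) n = (if n = j then u else 0)" for u n
    by (simp add: s_def l2_nth_Abs)
  have norm_s: "(norm (s u))\<^sup>2 = (norm u)\<^sup>2" for u
    using sums_unique2[OF sums_norm_l2[of "s u"]] sums[of u] by (simp add: nth)
  have "bounded_linear s"
  proof (rule bounded_linear_intro)
    show "s (x + y) = s x + s y" "s (r *\<^sub>R x) = r *\<^sub>R s x" for x y r
      by (rule l2_eqI, simp add: nth)+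
    show "norm (s x) \<le> norm x * 1" for x
      using norm_s[of x] by simp
  qed
  then have ap: "blinfun_apply (l2_single j) u = s u" for u
    by (simp add: l2_single_def s_def[abs_def, symmetric] bounded_linear_Blinfun_apply)
  show "l2_nth (l2_single j u) n = (if n = j then u else 0)"
    by (simp add: ap nth)
  show "complex_linear (l2_single j :: 'a \<Rightarrow>\<^sub>L 'a l2)"
    unfolding complex_linear_def by (intro allI l2_eqI) (simp add: ap nth)
qed

lemma inner_single: "inner (l2_single i u) (l2_single j v) = (if i = j then inner u v else 0)"
proof -
  have "(\<lambda>n. inner (l2_nth (l2_single i u) n) (l2_nth (l2_single j v) n)) sums (if i = j then inner u v else 0)"
    using sums_single[of i "\<lambda>_. if i = j then inner u v else 0"]
    by (rule sums_cong[THEN iffD1, rotated]) auto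
  then show ?thesis
    by (rule sums_unique2[OF sums_inner_l2])
qed

section \<open>Necessity: a Schur function from the Toeplitz contraction\<close>

lemma feedback_if_contraction:
  fixes A :: "nat \<Rightarrow> 'u::complex_hilbert_space \<Rightarrow>\<^sub>L 'y::complex_hilbert_space"
  assumes lin: "\<And>n. complex_linear (A n)"
    and contr: "contraction_to_l2 (Suc M) (block_toeplitz (Suc M) A)"
  obtains V :: "complex \<Rightarrow> 'u \<Rightarrow>\<^sub>L ('y \<times> 'u)" where "V \<in> schur_class"
    "\<And>z w. z \<in> \<bbbD> \<Longrightarrow>
      (\<lambda>n. z ^ n *\<^sub>C A n (w - z ^ Suc M *\<^sub>C snd (V z w))) sums fst (V z w)"
proof -
  obtain T :: "'u l2 \<Rightarrow>\<^sub>L 'y l2" where T: "complex_linear T" "norm T \<le> 1"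
    and T_nth: "\<And>u m. l2_nth (T u) m = block_toeplitz (Suc M) A (l2_nth u) m"
    using block_toeplitz_operator[OF lin contr] by metis
  obtain D :: "'u l2 \<Rightarrow>\<^sub>L 'u l2 l2" where D: "complex_linear D"
    and TD: "\<And>u. (norm (T u))\<^sup>2 + (norm (D u))\<^sup>2 = (norm u)\<^sup>2"
    using defect_operator_exists[OF T] by metis
  \<comment> \<open>\<open>v\<close> is \<open>u\<close> delayed by one; the support condition on
    \<open>u\<close> keeps \<open>v\<close> within the entries 0 to \<open>M\<close>.\<close>
  define shifted where "shifted u v \<longleftrightarrow> l2_nth v 0 = 0 \<and> (\<forall>m. l2_nth v (Suc m) = l2_nth u m) \<and>
    (\<forall>m\<ge>M. l2_nth u m = 0)" for u v :: "'u l2"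
  have T_shifted: "l2_nth (T v) 0 = 0" "l2_nth (T v) (Suc m) = l2_nth (T u) m" if "shifted u v" for u v m
    using that block_toeplitz_shift[where v = "l2_nth v" and u = "l2_nth u" and M = M and A = A] by (simp_all add: shifted_def T_nth)
  \<comment> \<open>\<open>D\<close> may have a kernel, so \<open>D v \<mapsto> D u\<close> is at
    first only a relation; the comparison of norms below makes it an isometric map.\<close>
  define G where "G = {(D v, D u) | u v. shifted u v}"
  have "complex_subspace G"
    unfolding complex_subspace_def
  proof (intro conjI ballI allI)
    have "shifted 0 0" by (simp add: shifted_def)
    then have "(D 0, D 0) \<in> G" unfolding G_def by blast
    then show "0 \<in> G" by (simp add: zero_prod_def)
  next
    fix p q assume "p \<in> G" "q \<in> G"
    then obtain u v u' v' where "shifted u v" "p = (D v, D u)" "shifted u' v'" "q = (D v', D u')"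
      by (auto simp: G_def)
    then have "shifted (u + u') (v + v')" "p + q = (D (v + v'), D (u + u'))"
      by (simp_all add: shifted_def blinfun.add_right)
    then show "p + q \<in> G" by (auto simp: G_def)
  next
    fix c p assume "p \<in> G"
    then obtain u v where "shifted u v" "p = (D v, D u)"
      by (auto simp: G_def)
    then have "shifted (c *\<^sub>C u) (c *\<^sub>C v)" "c *\<^sub>C p = (D (c *\<^sub>C v), D (c *\<^sub>C u))"
      by (simp_all add: shifted_def scaleC_prod_def complex_linearD[OF D])
    then show "c *\<^sub>C p \<in> G" by (auto simp: G_def)
  qed
  moreover have "norm f \<le> norm b" if "(b, f) \<in> G" for b f
  proof -
    obtain u v where uv: "shifted u v" "b = D v" "f = D u"
      using \<open>(b, f) \<in> G\<close> by (auto simp: G_def)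
    \<comment> \<open>The delay preserves the norms of both the input and its image under
      \<open>T\<close>, so by \<open>TD\<close> it preserves the norm of the defect.\<close>
    then have "norm v = norm u"
      by (intro norm_eq_if_shift) (simp_all add: shifted_def)
    moreover have "norm (T v) = norm (T u)"
      using T_shifted[OF uv(1)] by (intro norm_eq_if_shift)
    ultimately have "(norm f)\<^sup>2 = (norm b)\<^sup>2"
      using TD[of u] TD[of v] uv(2,3) by (metis add_left_cancel)
    then show ?thesis by simp
  qed
  ultimately obtain B :: "'u l2 l2 \<Rightarrow>\<^sub>L 'u l2 l2" where B: "complex_linear B" "norm B \<le> 1"
    and B_G: "\<And>b f. (b, f) \<in> G \<Longrightarrow> B b = f"
    using contraction_extending_relation by metis
  define Z :: "('y l2 \<times> 'u l2 l2) \<Rightarrow>\<^sub>L ('y l2 \<times> 'u l2 l2)"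
    where "Z = Blinfun (\<lambda>s. (l2_backshift (fst s), B (snd s)))"
  define C :: "('y l2 \<times> 'u l2 l2) \<Rightarrow>\<^sub>L 'y" where "C = Blinfun (\<lambda>s. l2_nth (fst s) 0)"
  define E where "E j = Blinfun (\<lambda>u. (T (l2_single j u), D (l2_single j u)))" for j
  have Z_ap: "Z s = (l2_backshift (fst s), B (snd s))" for s
    unfolding Z_def
    by (rule fun_cong[OF bounded_linear_Blinfun_apply])
       (intro bounded_linear_Pair bounded_linear_compose[OF blinfun.bounded_linear_right]
         bounded_linear_fst bounded_linear_snd)
  have C_ap: "C s = l2_nth (fst s) 0" for s
    unfolding C_def
  proof (rule fun_cong[OF bounded_linear_Blinfun_apply], rule bounded_linear_intro)
    show "norm (l2_nth (fst x) 0) \<le> norm x * 1" for x :: "'y l2 \<times> 'u l2 l2"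
      using norm_l2_nth_le[of "fst x" 0] norm_fst_le[of "fst x" "snd x"] by simp
  qed simp_all
  have E_ap: "E j u = (T (l2_single j u), D (l2_single j u))" for j u
    unfolding E_def
    by (rule fun_cong[OF bounded_linear_Blinfun_apply])
       (intro bounded_linear_Pair bounded_linear_compose[OF blinfun.bounded_linear_right]
         blinfun.bounded_linear_right)
  \<comment> \<open>Polarisation of \<open>TD\<close>; it makes the \<open>E j\<close> isometric
    with mutually orthogonal ranges.\<close>
  have inner_TD: "inner (T x) (T y) + inner (D x) (D y) = inner x y" for x y
    using TD[of "x + y"] TD[of x] TD[of y]
    by (simp add: power2_norm_eq_inner inner_add_left inner_add_right blinfun.add_right inner_commute)
  obtain V :: "complex \<Rightarrow> 'u \<Rightarrow>\<^sub>L ('y \<times> 'u)" where V: "V \<in> schur_class"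
    and V_sums: "\<And>z w. z \<in> \<bbbD> \<Longrightarrow>
      (\<lambda>n. z ^ n *\<^sub>C C ((blinfun_apply Z ^^ n) (E 0 (w - z ^ Suc M *\<^sub>C snd (V z w))))) sums fst (V z w)"
  proof (rule schur_function_of_shift[of Z C E M])
    show "complex_linear Z"
      unfolding complex_linear_def
      by (auto simp: Z_ap scaleC_prod_def complex_linearD[OF B(1)] intro!: l2_eqI)
    show "complex_linear C"
      by (simp add: complex_linear_def C_ap)
    show "complex_linear (E j)" for j
      by (simp add: complex_linear_def E_ap scaleC_prod_def complex_linearD[OF T(1)] complex_linearD[OF D]
          complex_linearD[OF complex_linear_single])
    show "(norm (Z s))\<^sup>2 + (norm (C s))\<^sup>2 \<le> (norm s)\<^sup>2" for s
    proof -
      have "(norm (B (snd s)))\<^sup>2 \<le> (norm (snd s))\<^sup>2"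
        by (intro power_mono norm_blinfun_le_1D[OF B(2)] norm_ge_zero)
      moreover have "(norm (Z s))\<^sup>2 + (norm (C s))\<^sup>2 = (norm (l2_backshift (fst s)))\<^sup>2
          + (norm (B (snd s)))\<^sup>2 + (norm (l2_nth (fst s) 0))\<^sup>2"
        by (simp add: Z_ap C_ap norm_prod_def)
      moreover have "(norm s)\<^sup>2 = (norm (fst s))\<^sup>2 + (norm (snd s))\<^sup>2"
        by (simp add: norm_prod_def)
      ultimately show ?thesis
        using norm_l2_backshift[of "fst s"] by linarith
    qed
    show "inner (E i u) (E j v) = (if i = j then inner u v else 0)" for i j u v
      by (simp only: E_ap inner_prod_def fst_conv snd_conv inner_TD inner_single)
    show "Z (E (Suc j) u) = E j u" if "j < M" for j u
    proof -
      have sh: "shifted (l2_single j u) (l2_single (Suc j) u)"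
        using that by (auto simp: shifted_def)
      then have "(D (l2_single (Suc j) u), D (l2_single j u)) \<in> G"
        by (auto simp: G_def)
      moreover have "l2_backshift (T (l2_single (Suc j) u)) = T (l2_single j u)"
        using T_shifted[OF sh] by (intro l2_eqI) simp
      ultimately show ?thesis by (simp add: Z_ap E_ap B_G)
    qed
  qed (use that in blast)
  \<comment> \<open>\<open>C\<close> sees only the first component, where \<open>Z\<close> is the
    backward shift. So \<open>n\<close> steps followed by \<open>C\<close> read off entry
    \<open>n\<close> of the first Toeplitz column.\<close>
  have Zn: "l2_nth (fst ((blinfun_apply Z ^^ n) s)) m = l2_nth (fst s) (m + n)" for n m s
    by (induction n arbitrary: m) (simp_all add: Z_ap)
  have "C ((blinfun_apply Z ^^ n) (E 0 w)) = A n w" for n w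
  proof -
    have "C ((blinfun_apply Z ^^ n) (E 0 w)) = block_toeplitz (Suc M) A (l2_nth (l2_single 0 w)) n"
      by (simp add: C_ap Zn E_ap T_nth)
    also have "\<dots> = A n w"
      unfolding block_toeplitz_def sum.lessThan_Suc_shift by (simp cong: if_cong)
    finally show ?thesis .
  qed
  then show thesis
    using V V_sums by (intro that) simp_all
qed

section \<open>The feedback formula for \<open>H\<close> and the equivalence\<close>

theorem corollary3p4:
  fixes N :: nat
    and H :: "complex \<Rightarrow> 'u::complex_hilbert_space \<Rightarrow>\<^sub>L 'y::complex_hilbert_space"
    and Hn :: "nat \<Rightarrow> 'u \<Rightarrow>\<^sub>L 'y"
  assumes "N > 0"
    and "H \<in> operator_hardy2"
    and "taylor_coeffs_at_0 H Hn"
  shows "contraction_to_l2 N (block_toeplitz N Hn) \<longleftrightarrow>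
    (\<exists>V :: complex \<Rightarrow> 'u \<Rightarrow>\<^sub>L ('y \<times> 'u). V \<in> schur_class \<and>
      (\<forall>z\<in>\<bbbD>. H z =
        fst_blinfun o\<^sub>L V z o\<^sub>L blinfun_inverse (id_blinfun - z ^ N *\<^sub>C (snd_blinfun o\<^sub>L V z))))"
proof
  assume contr: "contraction_to_l2 N (block_toeplitz N Hn)"
  obtain M where N: "N = Suc M"
    using \<open>N > 0\<close> gr0_implies_Suc by blast
  have lin: "complex_linear (Hn n)" for n
    using assms(2,3) by (intro complex_linear_taylor_coeff) (auto simp: operator_hardy2_def)
  obtain V :: "complex \<Rightarrow> 'u \<Rightarrow>\<^sub>L ('y \<times> 'u)" where V: "V \<in> schur_class"
    and V_sums: "\<And>z w. z \<in> \<bbbD> \<Longrightarrow>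
      (\<lambda>n. z ^ n *\<^sub>C Hn n (w - z ^ N *\<^sub>C snd (V z w))) sums fst (V z w)"
    by (rule feedback_if_contraction[OF lin contr[unfolded N], folded N]) blast
  have "H z = fst_blinfun o\<^sub>L V z o\<^sub>L blinfun_inverse (id_blinfun - z ^ N *\<^sub>C (snd_blinfun o\<^sub>L V z))"
    if z: "z \<in> \<bbbD>" for z
  proof (rule blinfun_eqI)
    fix u
    let ?W = "z ^ N *\<^sub>C (snd_blinfun o\<^sub>L V z)"
    \<comment> \<open>This choice makes \<open>?w - z ^ N *\<^sub>C snd (V z ?w)\<close> equal to
      \<open>u\<close>, so that the series in \<open>V_sums\<close> becomes the Taylor series of
      \<open>H\<close> applied to \<open>u\<close>.\<close>
    let ?w = "blinfun_inverse (id_blinfun - ?W) u"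
    have "norm ?W < 1"
      using V z \<open>N > 0\<close> by (intro feedback_norm_less_1) (auto simp: schur_class_def)
    then have "?w - z ^ N *\<^sub>C snd (V z ?w) = u"
      using blinfun_inverse_fixpoint[of ?W u] by (simp add: scaleC_blinfun.rep_eq)
    then have "(\<lambda>n. z ^ n *\<^sub>C Hn n u) sums fst (V z ?w)"
      using V_sums[OF z, of ?w] by simp
    moreover have "(\<lambda>n. z ^ n *\<^sub>C Hn n u) sums H z u"
      using assms(3) z by (simp add: taylor_coeffs_at_0_def)
    ultimately show "H z u = (fst_blinfun o\<^sub>L V z o\<^sub>L blinfun_inverse (id_blinfun - ?W)) u"
      using sums_unique2 by simp
  qed
  then show "\<exists>V :: complex \<Rightarrow> 'u \<Rightarrow>\<^sub>L ('y \<times> 'u). V \<in> schur_class \<and>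
      (\<forall>z\<in>\<bbbD>. H z =
        fst_blinfun o\<^sub>L V z o\<^sub>L blinfun_inverse (id_blinfun - z ^ N *\<^sub>C (snd_blinfun o\<^sub>L V z)))"
    using V by blast
next
  assume "\<exists>V :: complex \<Rightarrow> 'u \<Rightarrow>\<^sub>L ('y \<times> 'u). V \<in> schur_class \<and>
      (\<forall>z\<in>\<bbbD>. H z =
        fst_blinfun o\<^sub>L V z o\<^sub>L blinfun_inverse (id_blinfun - z ^ N *\<^sub>C (snd_blinfun o\<^sub>L V z)))"
  then show "contraction_to_l2 N (block_toeplitz N Hn)"
    using contraction_if_feedback[OF assms(1,3)] by blast
qed

end
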